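(* As $n=2^k\to\infty$ over powers of $2$, the relaxation time of the edge-flip Markov chain $\mathcal{M}_k$ on dyadic tilings of size $n$ is at most $O(n^{\log 17})$. As a consequence, the mixing time $t_{\mathrm{mix}}$ of this chain is at most $O(n^{1+\log 17})$. Here $\log$ denotes the logarithm to base $2$.
   Context: A dyadic interval is an interval of the form $[a2^{-s},(a+1)2^{-s}]$ with $a,s$ non-negative integers and $0\le a<2^s$. A dyadic rectangle is the Cartesian product of two dyadic intervals. For $n=2^k$, a dyadic tiling of size $n$ is a tiling of the unit square $[0,1]^2$ by $n$ dyadic rectangles, each of area $1/n=2^{-k}$, that do not overlap except on their boundaries. $\Omega_k$ is the (finite) set of all dyadic tilings of size $2^k$. Edge-flip Markov chain $\mathcal{M}_k$ ($k\ge 1$, $n=2^k$) on state space $\Omega_k$: from the current tiling $\sigma_i$, choose a rectangle $R$ of $\sigma_i$ uniformly at random; choose left, right, top or bottom uniformly at random and let $e$ be the corresponding side of $R$. If $e$ bisects a rectangle of area $2^{-k+1}$ (i.e. $e$ is the common full side of two rectangles of $\sigma_i$ whose union is a rectangle), remove $e$ and replace it with its perpendicular bisector (so that this rectangle of area $2^{-k+1}$ is bisected in the other direction) to obtain $\sigma_{i+1}$, if the result is a valid dyadic tiling; otherwise set $\sigma_{i+1}=\sigma_i$. Equivalently, any two distinct tilings differing by one edge flip have transition probability $1/(2n)$ in each direction, all other off-diagonal transition probabilities are $0$, and the remaining mass is on the diagonal. The chain is lazy, irreducible and reversible, with uniform stationary distribution $\pi$ on $\Omega_k$. The spectral gap of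 a reversible transition matrix $P$ is $1-\lambda_2$, where $\lambda_2$ is its second largest eigenvalue; the relaxation time of a lazy chain is the inverse of its spectral gap. The mixing time is $t_{\mathrm{mix}}=t_{\mathrm{mix}}(1/4)$, where $t_{\mathrm{mix}}(\varepsilon)=\min\{t:\ \|P^{t'}-\pi\|_{\mathrm{TV}}\le\varepsilon \text{ for all } t'\ge t\}$ and $\|P^t-\pi\|_{\mathrm{TV}}=\max_{x}\frac12\sum_{y}|P^t(x,y)-\pi(y)|$. *)

theory Defs
  imports
    "HOL-Probability.Probability"
    "HOL-Computational_Algebra.Computational_Algebra"
    "Jordan_Normal_Form.Char_Poly"
begin

section \<open>Dyadic tilings\<close>

definition dyadic_interval :: "real set \<Rightarrow> bool" where
  "dyadic_interval I \<longleftrightarrow>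
     (\<exists>a s :: nat. a < 2 ^ s \<and> I = {real a / 2 ^ s .. (real a + 1) / 2 ^ s})"

definition dyadic_rectangle :: "(real \<times> real) set \<Rightarrow> bool" where
  "dyadic_rectangle R \<longleftrightarrow> (\<exists>I J. dyadic_interval I \<and> dyadic_interval J \<and> R = I \<times> J)"

definition dyadic_tilings :: "nat \<Rightarrow> (real \<times> real) set set set" where
  "dyadic_tilings k =
     {\<sigma>. \<sigma> division_of ({0..1} \<times> {0..1}) \<and> card \<sigma> = 2 ^ k \<and>
          (\<forall>R\<in>\<sigma>. dyadic_rectangle R \<and> measure lborel R = 1 / 2 ^ k)}"

section \<open>The edge-flip chain\<close>

datatype direction = LeftSide | RightSide | TopSide | BottomSide

fun side_of :: "direction \<Rightarrow> (real \<times> real) set \<Rightarrow> (real \<times> real) set" where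
  "side_of LeftSide R = {p \<in> R. \<forall>q\<in>R. fst p \<le> fst q}"
| "side_of RightSide R = {p \<in> R. \<forall>q\<in>R. fst q \<le> fst p}"
| "side_of TopSide R = {p \<in> R. \<forall>q\<in>R. snd q \<le> snd p}"
| "side_of BottomSide R = {p \<in> R. \<forall>q\<in>R. snd p \<le> snd q}"

definition vertical_halves :: "real \<Rightarrow> real \<Rightarrow> real \<Rightarrow> real \<Rightarrow> (real \<times> real) set set" where
  "vertical_halves a b c d = {{a..(a + b) / 2} \<times> {c..d}, {(a + b) / 2..b} \<times> {c..d}}"

definition horizontal_halves :: "real \<Rightarrow> real \<Rightarrow> real \<Rightarrow> real \<Rightarrow> (real \<times> real) set set" where
  "horizontal_halves a b c d = {{a..b} \<times> {c..(c + d) / 2}, {a..b} \<times> {(c + d) / 2..d}}"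

text \<open>\<open>replaces_bisector \<sigma> e \<tau>\<close>: the segment \<open>e\<close> bisects a rectangle
  \<open>{a..b} \<times> {c..d}\<close> whose two halves belong to \<open>\<sigma>\<close>, and \<open>\<tau>\<close> arises from \<open>\<sigma>\<close>
  by replacing \<open>e\<close> with the perpendicular bisector of that rectangle. If all members of \<open>\<sigma>\<close>
  have area \<open>2 ^ - k\<close>, the bisected rectangle necessarily has area \<open>2 ^ (1 - k)\<close>.
  The set \<open>\<tau>\<close> need not be a dyadic tiling, since the bisected rectangle or its new halves
  need not be dyadic.\<close>

inductive replaces_bisector ::
  "(real \<times> real) set set \<Rightarrow> (real \<times> real) set \<Rightarrow> (real \<times> real) set set \<Rightarrow> bool" where
  vertical: "a < b \<Longrightarrow> c < d \<Longrightarrow> vertical_halves a b c d \<subseteq> \<sigma> \<Longrightarrow>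
     replaces_bisector \<sigma> ({(a + b) / 2} \<times> {c..d})
       (\<sigma> - vertical_halves a b c d \<union> horizontal_halves a b c d)"
| horizontal: "a < b \<Longrightarrow> c < d \<Longrightarrow> horizontal_halves a b c d \<subseteq> \<sigma> \<Longrightarrow>
     replaces_bisector \<sigma> ({a..b} \<times> {(c + d) / 2})
       (\<sigma> - horizontal_halves a b c d \<union> vertical_halves a b c d)"

text \<open>In a tiling the two rectangles having \<open>e\<close> as a full side are determined by \<open>e\<close>, because
  tiles do not overlap. Hence at most one \<open>\<tau>\<close> qualifies and the description below is
  well defined.\<close>

definition flip_edge ::
  "nat \<Rightarrow> (real \<times> real) set set \<Rightarrow> (real \<times> real) set \<Rightarrow> (real \<times> real) set set" where
  "flip_edge k \<sigma> e =
     (if \<exists>\<tau>\<in>dyadic_tilings k. replaces_bisector \<sigma> e \<tau>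
      then THE \<tau>. \<tau> \<in> dyadic_tilings k \<and> replaces_bisector \<sigma> e \<tau>
      else \<sigma>)"

definition edge_flip_chain :: "nat \<Rightarrow> (real \<times> real) set set \<Rightarrow> (real \<times> real) set set pmf" where
  "edge_flip_chain k \<sigma> =
     do {
       R \<leftarrow> pmf_of_set \<sigma>;
       s \<leftarrow> pmf_of_set {LeftSide, RightSide, TopSide, BottomSide};
       return_pmf (flip_edge k \<sigma> (side_of s R))
     }"

section \<open>Relaxation time and mixing time of a finite reversible chain\<close>

text \<open>The states are enumerated in an arbitrary order; the characteristic polynomial does not
  depend on it.\<close>

definition transition_matrix :: "'a set \<Rightarrow> ('a \<Rightarrow> 'a pmf) \<Rightarrow> real mat" where
  "transition_matrix S K =
     (let xs = (SOME xs. distinct xs \<and> set xs = S)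
      in Matrix.mat (length xs) (length xs) (\<lambda>(i, j). pmf (K (xs ! i)) (xs ! j)))"

text \<open>Eigenvalues with multiplicity, in decreasing order. For a reversible chain all complex
  roots of the characteristic polynomial are real.\<close>

definition eigenvalues_desc :: "real mat \<Rightarrow> real list" where
  "eigenvalues_desc A = rev (sorted_list_of_multiset (proots (char_poly A)))"

definition spectral_gap :: "'a set \<Rightarrow> ('a \<Rightarrow> 'a pmf) \<Rightarrow> real" where
  "spectral_gap S K = 1 - eigenvalues_desc (transition_matrix S K) ! 1"

text \<open>Extended-valued, so that a vanishing gap gives an infinite relaxation time.\<close>

definition relaxation_time :: "'a set \<Rightarrow> ('a \<Rightarrow> 'a pmf) \<Rightarrow> ennreal" where
  "relaxation_time S K = inverse (ennreal (spectral_gap S K))"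

definition step_distribution :: "('a \<Rightarrow> 'a pmf) \<Rightarrow> nat \<Rightarrow> 'a \<Rightarrow> 'a pmf" where
  "step_distribution K t x = ((\<lambda>p. bind_pmf p K) ^^ t) (return_pmf x)"

definition tv_distance :: "'a set \<Rightarrow> ('a \<Rightarrow> 'a pmf) \<Rightarrow> 'a pmf \<Rightarrow> nat \<Rightarrow> real" where
  "tv_distance S K \<pi> t =
     Max ((\<lambda>x. 1 / 2 * (\<Sum>y\<in>S. \<bar>pmf (step_distribution K t x) y - pmf \<pi> y\<bar>)) ` S)"

text \<open>Extended-valued: infinite if no such time \<open>t\<close> exists, and otherwise the minimum.\<close>

definition mixing_time :: "'a set \<Rightarrow> ('a \<Rightarrow> 'a pmf) \<Rightarrow> 'a pmf \<Rightarrow> real \<Rightarrow> enat" where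
  "mixing_time S K \<pi> \<epsilon> = (INF t \<in> {t. \<forall>t'\<ge>t. tv_distance S K \<pi> t' \<le> \<epsilon>}. enat t)"

end

theory Submission
  imports Defs "HOL-Library.Sublist" "Jordan_Normal_Form.Schur_Decomposition"
begin

text \<open>A dyadic tiling of size \<open>2 ^ (k + 1)\<close> is bisected by the line \<open>x = 1/2\<close> or by the line
  \<open>y = 1/2\<close>: a tile crossing the first line has full width, a tile crossing the second has full
  height, two such tiles would overlap, and no tile is the whole square. Hence the set \<open>\<Omega>\<close> of these tilings is \<open>V \<union> H\<close>, where
  \<open>V\<close> and \<open>H\<close> are both copies of \<open>B \<times> B\<close> for the set \<open>B\<close> of tilings of size \<open>2 ^ k\<close>, and
  \<open>V \<inter> H\<close> contains all tilings composed of four tilings of size \<open>2 ^ (k - 1)\<close>.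

  The relaxation time is bounded by a Poincare inequality that is proved by induction on \<open>k\<close>.
  For a real function \<open>f\<close> on \<open>\<Omega>\<close> let \<open>S(X)\<close> be the sum of \<open>(f x - f y)\<^sup>2\<close> over all pairs
  \<open>x, y\<close> of elements of \<open>X\<close>, and let \<open>D\<close> be the sum of the same terms over those pairs that differ
  by one flip. Connecting a point of \<open>V - H\<close> to a point of \<open>H - V\<close> through all points of \<open>V \<inter> H\<close>
  gives
  \<open>\<bar>V \<inter> H\<bar> S(\<Omega>) \<le> \<bar>\<Omega>\<bar> (S(V) + S(H))\<close> (\<open>sqd_two_cover_le\<close>).
  On the product sets \<open>V\<close> and \<open>H\<close> the variance is at most the sum of the variances in the two
  factors (\<open>sqd_product_le\<close>), to which the induction hypothesis applies; a flip in one half of a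
  tiling is a flip of the whole tiling. Since \<open>\<bar>B\<bar>\<close> is at most twice the square of the number of
  tilings one level below, \<open>\<bar>V\<bar> = \<bar>B\<bar>\<^sup>2 \<le> 4 \<bar>V \<inter> H\<bar>\<close>. Together these facts give
  \<open>S(\<Omega>) \<le> \<bar>\<Omega>\<bar> 8 ^ k D\<close> (\<open>poincare_tilings\<close>). A flip has probability \<open>1 / (2 * 2 ^ (k + 1))\<close>, so the
  relaxation time at level \<open>k + 1\<close> is at most \<open>4 * 16 ^ k\<close>, which is smaller than
  \<open>17 ^ (k + 1) = (2 ^ (k + 1)) powr log 2 17\<close>.

  The eigenvalues are controlled by a triangularization of the symmetric transition matrix. Its
  eigenvalues other than 1 are bounded by the Poincare inequality, and 1 is a simple root of the
  characteristic polynomial because a generalized eigenvector for 1 would be constant.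
  For the mixing time, laziness gives \<open>\<parallel>P f\<parallel>\<^sup>2 \<le> \<langle>f, P f\<rangle>\<close>, so each step contracts the squared distance to
  the uniform distribution by the factor \<open>1 - 1 / T\<close>; moreover there are at most
  \<open>2 ^ 2 ^ k\<close> tilings of size \<open>2 ^ k\<close>, which costs one more factor \<open>2 ^ k\<close>.

  All combinatorics is carried out on an encoding of dyadic intervals as bit lists, the
  successive choices of the lower or upper half; it is linked to the tilings by sets of reals in
  \<open>dyadic_tilings_eq\<close> and to the chain in \<open>pmf_edge_flip_chain_offdiagonal\<close>.\<close>

section \<open>Spectral gap and mixing time from a Poincare inequality\<close>

lemma real_symmetric_char_poly_splits:
  fixes A :: "real mat"
  assumes A: "A \<in> carrier_mat n n"
    and sym: "\<And>i j. i < n \<Longrightarrow> j < n \<Longrightarrow> A $$ (i, j) = A $$ (j, i)"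
  shows "\<exists>es. char_poly A = (\<Prod>e\<leftarrow>es. [:- e, 1:]) \<and> length es = n"
proof -
  let ?h = "of_real :: real \<Rightarrow> complex"
  interpret of_real_hom: comm_ring_hom ?h by unfold_locales auto
  define B where "B = map_mat ?h A"
  have B: "B \<in> carrier_mat n n" using A by (simp add: B_def)
  have real_root: "c \<in> \<real>" if "poly (char_poly B) c = 0" for c
  proof -
    from that have "eigenvalue B c" using eigenvalue_root_char_poly[OF B] by simp
    then obtain v where v: "v \<in> carrier_vec n" "v \<noteq> 0\<^sub>v n" "B *\<^sub>v v = c \<cdot>\<^sub>v v"
      using B by (auto simp: eigenvalue_def eigenvector_def)
    have ev: "(\<Sum>j<n. ?h (A $$ (i, j)) * v $ j) = c * v $ i" if "i < n" for i
    proof -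
      have "(B *\<^sub>v v) $ i = (\<Sum>j<n. ?h (A $$ (i, j)) * v $ j)"
        using that A v(1) by (simp add: B_def scalar_prod_def lessThan_atLeast0)
      thus ?thesis using v that by simp
    qed
    define q where "q = (\<Sum>i<n. \<Sum>j<n. cnj (v $ i) * ?h (A $$ (i, j)) * v $ j)"
    have "cnj q = (\<Sum>i<n. \<Sum>j<n. v $ i * ?h (A $$ (i, j)) * cnj (v $ j))"
      by (simp add: q_def)
    also have "\<dots> = (\<Sum>j<n. \<Sum>i<n. v $ i * ?h (A $$ (i, j)) * cnj (v $ j))"
      by (rule sum.swap)
    also have "\<dots> = q" unfolding q_def
      by (intro sum.cong refl) (auto simp: sym)
    finally have q_real: "q \<in> \<real>" using Reals_cnj_iff by blast
    have "q = (\<Sum>i<n. cnj (v $ i) * (\<Sum>j<n. ?h (A $$ (i, j)) * v $ j))"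
      by (simp add: q_def sum_distrib_left mult.assoc)
    also have "\<dots> = (\<Sum>i<n. c * (v $ i * cnj (v $ i)))"
      by (intro sum.cong refl) (simp add: ev)
    also have "\<dots> = c * ?h (\<Sum>i<n. (cmod (v $ i))\<^sup>2)"
      by (simp only: complex_norm_square[symmetric] sum_distrib_left of_real_sum)
    finally have q: "q = c * ?h (\<Sum>i<n. (cmod (v $ i))\<^sup>2)" .
    obtain i where i: "i < n" "v $ i \<noteq> 0"
      using v by (metis carrier_vecD eq_vecI index_zero_vec(1) index_zero_vec(2))
    have "(\<Sum>i<n. (cmod (v $ i))\<^sup>2) > 0"
      by (rule sum_pos2[of _ i]) (use i in auto)
    hence "?h (\<Sum>i<n. (cmod (v $ i))\<^sup>2) \<noteq> 0" by (metis less_irrefl of_real_eq_0_iff)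
    hence "c = q / ?h (\<Sum>i<n. (cmod (v $ i))\<^sup>2)" using q by (metis nonzero_mult_div_cancel_right)
    thus ?thesis using q_real by simp
  qed
  obtain as where as: "char_poly B = (\<Prod>a\<leftarrow>as. [:- a, 1:])" "length as = n"
    using char_poly_factorized[OF B] by blast
  have as_real: "a \<in> \<real>" if "a \<in> set as" for a
  proof (rule real_root)
    show "poly (char_poly B) a = 0" unfolding as(1) using that
      by (induction as) auto
  qed
  define es where "es = map Re as"
  have as_es: "as = map ?h es"
    unfolding es_def using as_real by (induction as) auto
  have "map_poly ?h (char_poly A) = char_poly B"
    unfolding B_def by (rule of_real_hom.char_poly_hom[OF A, symmetric])
  also have "\<dots> = map_poly ?h (\<Prod>e\<leftarrow>es. [:- e, 1:])"
  proof -
    interpret mp: map_poly_comm_ring_hom ?h ..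
    have "(\<Prod>a\<leftarrow>map ?h es. [:- a, 1:]) = map_poly ?h (\<Prod>e\<leftarrow>es. [:- e, 1:])" for es :: "real list"
      by (induction es) (simp_all add: mp.hom_mult del: mult_pCons_left)
    thus ?thesis using as(1) as_es by simp
  qed
  finally have "char_poly A = (\<Prod>e\<leftarrow>es. [:- e, 1:])"
    by (metis (no_types, lifting) coeff_map_poly of_real_0 of_real_eq_iff poly_eq_iff)
  moreover have "length es = n" using as(2) by (simp add: es_def)
  ultimately show ?thesis by blast
qed

text \<open>If the characteristic polynomial splits over the reals, then
  \<^const>\<open>eigenvalues_desc\<close> lists all its roots with multiplicity.\<close>

lemma eigenvalues_desc_linear_factors:
  assumes "char_poly A = (\<Prod>e\<leftarrow>es. [:- e, 1:])"
  shows "eigenvalues_desc A = rev (sort es)"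
proof -
  have "proots (\<Prod>e\<leftarrow>es. [:- e, 1:]) = mset es"
  proof (induction es)
    case (Cons e es)
    have "(\<Prod>e\<leftarrow>es. [:- e, 1:]) \<noteq> 0" by (auto simp: prod_list_zero_iff)
    thus ?case using Cons by (simp add: proots_mult del: mult_pCons_left)
  qed simp
  thus ?thesis using assms by (simp add: eigenvalues_desc_def sorted_list_of_multiset_mset)
qed

text \<open>A finite chain with symmetric transition matrix, hence with uniform stationary
  distribution, that satisfies a Poincare inequality with constant \<open>T\<close>. In the usual
  normalization both sides are divided by \<open>2 * (card S)\<^sup>2\<close>; the inequality then
  says that the variance of \<open>f\<close> is at most \<open>T\<close> times the Dirichlet form of
  \<open>f\<close>.\<close>

locale poincare_chain =
  fixes S :: "'a set" and K :: "'a \<Rightarrow> 'a pmf" and T :: real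
  assumes finite_states: "finite S"
    and set_pmf_subset: "x \<in> S \<Longrightarrow> set_pmf (K x) \<subseteq> S"
    and symmetric: "x \<in> S \<Longrightarrow> y \<in> S \<Longrightarrow> pmf (K x) y = pmf (K y) x"
    and T_pos: "T > 0"
    and poincare: "(\<Sum>x\<in>S. \<Sum>y\<in>S. (f x - f y)\<^sup>2)
      \<le> T * card S * (\<Sum>x\<in>S. \<Sum>y\<in>S. pmf (K x) y * (f x - f y :: real)\<^sup>2)"
begin

text \<open>The transition matrix acting on functions from the left.\<close>

definition step :: "('a \<Rightarrow> real) \<Rightarrow> 'a \<Rightarrow> real" where
  "step f x = (\<Sum>y\<in>S. pmf (K x) y * f y)"

lemma row_sum: "x \<in> S \<Longrightarrow> (\<Sum>y\<in>S. pmf (K x) y) = 1"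
  using finite_states set_pmf_subset by (rule sum_pmf_eq_1)

lemma column_sum: assumes "y \<in> S" shows "(\<Sum>x\<in>S. pmf (K x) y) = 1"
proof -
  have "(\<Sum>x\<in>S. pmf (K x) y) = (\<Sum>x\<in>S. pmf (K y) x)"
    using assms by (intro sum.cong) (auto intro: symmetric)
  thus ?thesis using row_sum[OF assms] by simp
qed

lemma step_adjoint: "(\<Sum>x\<in>S. g x * step f x) = (\<Sum>x\<in>S. step g x * f x)"
proof -
  have "(\<Sum>x\<in>S. g x * step f x) = (\<Sum>x\<in>S. \<Sum>y\<in>S. g x * (pmf (K x) y * f y))"
    by (simp add: step_def sum_distrib_left)
  also have "\<dots> = (\<Sum>y\<in>S. \<Sum>x\<in>S. g x * (pmf (K x) y * f y))" by (rule sum.swap)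
  also have "\<dots> = (\<Sum>y\<in>S. \<Sum>x\<in>S. pmf (K y) x * g x * f y)"
    by (intro sum.cong refl) (simp add: symmetric)
  finally show ?thesis by (simp add: step_def sum_distrib_right)
qed

lemma sum_step: "(\<Sum>x\<in>S. step f x) = (\<Sum>x\<in>S. f x)"
  using step_adjoint[of "\<lambda>_. 1" f] by (simp add: step_def row_sum)

lemma dirichlet_form_eq:
  "(\<Sum>x\<in>S. \<Sum>y\<in>S. pmf (K x) y * (f x - f y)\<^sup>2) = 2 * ((\<Sum>x\<in>S. (f x)\<^sup>2) - (\<Sum>x\<in>S. f x * step f x))"
proof -
  have "(\<Sum>x\<in>S. \<Sum>y\<in>S. pmf (K x) y * (f x - f y)\<^sup>2) =
    (\<Sum>x\<in>S. (\<Sum>y\<in>S. pmf (K x) y) * (f x)\<^sup>2) + (\<Sum>x\<in>S. \<Sum>y\<in>S. pmf (K x) y * (f y)\<^sup>2)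
      - 2 * (\<Sum>x\<in>S. f x * step f x)"
    by (simp add: power2_diff step_def algebra_simps sum.distrib sum_subtractf sum_distrib_left sum_distrib_right)
  also have "(\<Sum>x\<in>S. \<Sum>y\<in>S. pmf (K x) y * (f y)\<^sup>2) = (\<Sum>y\<in>S. (\<Sum>x\<in>S. pmf (K x) y) * (f y)\<^sup>2)"
    by (subst sum.swap) (simp add: sum_distrib_right)
  finally show ?thesis by (simp add: row_sum column_sum)
qed

lemma step_fixed_imp_constant:
  assumes "\<And>x. x \<in> S \<Longrightarrow> step f x = f x" "x \<in> S" "y \<in> S"
  shows "f x = f y"
proof -
  have "(\<Sum>x\<in>S. \<Sum>y\<in>S. (f x - f y)\<^sup>2) \<le> 0"
  proof -
    have "(\<Sum>x\<in>S. f x * step f x) = (\<Sum>x\<in>S. (f x)\<^sup>2)"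
      using assms(1) by (simp add: power2_eq_square)
    thus ?thesis using poincare[of f] by (simp add: dirichlet_form_eq)
  qed
  hence "(\<Sum>x\<in>S. \<Sum>y\<in>S. (f x - f y)\<^sup>2) = 0"
    by (intro antisym sum_nonneg) auto
  hence "(\<Sum>y\<in>S. (f x - f y)\<^sup>2) = 0"
    using assms(2) by (subst (asm) sum_nonneg_eq_0_iff) (auto intro: sum_nonneg finite_states)
  thus ?thesis using assms(3) by (subst (asm) sum_nonneg_eq_0_iff) (auto intro: finite_states)
qed

lemma step_mean_zero_le:
  assumes "(\<Sum>x\<in>S. f x) = 0"
  shows "(\<Sum>x\<in>S. f x * step f x) \<le> (1 - 1 / T) * (\<Sum>x\<in>S. (f x)\<^sup>2)"
proof (cases "S = {}")
  case False
  hence N: "real (card S) > 0" using finite_states by (simp add: card_gt_0_iff)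
  have "(\<Sum>x\<in>S. \<Sum>y\<in>S. (f x - f y)\<^sup>2) =
      2 * card S * (\<Sum>x\<in>S. (f x)\<^sup>2) - 2 * (\<Sum>x\<in>S. \<Sum>y\<in>S. f x * f y)"
    by (simp add: power2_diff sum.distrib sum_subtractf sum_distrib_left algebra_simps)
  also have "(\<Sum>x\<in>S. \<Sum>y\<in>S. f x * f y) = (\<Sum>x\<in>S. f x) * (\<Sum>y\<in>S. f y)"
    by (simp add: sum_product)
  finally have "2 * card S * (\<Sum>x\<in>S. (f x)\<^sup>2) \<le>
      T * card S * (2 * ((\<Sum>x\<in>S. (f x)\<^sup>2) - (\<Sum>x\<in>S. f x * step f x)))"
    using poincare[of f] assms by (simp add: dirichlet_form_eq)
  hence "(2 * card S) * (\<Sum>x\<in>S. (f x)\<^sup>2) \<le>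
      (2 * card S) * (T * ((\<Sum>x\<in>S. (f x)\<^sup>2) - (\<Sum>x\<in>S. f x * step f x)))"
    by (simp add: algebra_simps)
  hence "(\<Sum>x\<in>S. (f x)\<^sup>2) \<le> T * ((\<Sum>x\<in>S. (f x)\<^sup>2) - (\<Sum>x\<in>S. f x * step f x))"
    using N by (simp only: mult_le_cancel_left_pos)
  thus ?thesis using T_pos by (simp add: field_simps)
qed simp

lemma eigenvalue_le:
  assumes ev: "\<And>x. x \<in> S \<Longrightarrow> step f x = c * f x" and "x \<in> S" "f x \<noteq> 0" "c \<noteq> 1"
  shows "c \<le> 1 - 1 / T"
proof -
  have "c * (\<Sum>x\<in>S. f x) = (\<Sum>x\<in>S. f x)"
    using sum_step[of f] ev by (simp add: sum_distrib_left)
  hence "(\<Sum>x\<in>S. f x) = 0" using assms(4) by simp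
  moreover have "(\<Sum>x\<in>S. f x * step f x) = c * (\<Sum>x\<in>S. (f x)\<^sup>2)"
    using ev by (simp add: sum_distrib_left power2_eq_square mult_ac)
  moreover have "(\<Sum>x\<in>S. (f x)\<^sup>2) > 0"
    by (rule sum_pos2[of _ x]) (use assms finite_states in auto)
  ultimately show ?thesis using step_mean_zero_le[of f] by simp
qed

text \<open>A generalized eigenvector of rank two for the eigenvalue 1 is an eigenvector: by
  self-adjointness \<open>P f2 - f2 = b f1\<close> is orthogonal to the fixed function
  \<open>f1\<close>.\<close>

lemma generalized_eigenvector_constant:
  assumes f1: "\<And>x. x \<in> S \<Longrightarrow> step f1 x = f1 x"
    and f2: "\<And>x. x \<in> S \<Longrightarrow> step f2 x = f2 x + b * f1 x"
    and "x \<in> S" "y \<in> S"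
  shows "f2 x = f2 y"
proof (rule step_fixed_imp_constant)
  have "(\<Sum>x\<in>S. (b * f1 x)\<^sup>2) = b * ((\<Sum>x\<in>S. f1 x * step f2 x) - (\<Sum>x\<in>S. f1 x * f2 x))"
    by (simp add: f2 power2_eq_square sum_distrib_left sum_subtractf[symmetric] algebra_simps sum.distrib)
  also have "(\<Sum>x\<in>S. f1 x * step f2 x) = (\<Sum>x\<in>S. f1 x * f2 x)"
    by (simp add: step_adjoint f1)
  finally have "(\<Sum>x\<in>S. (b * f1 x)\<^sup>2) = 0" by simp
  hence "\<forall>x\<in>S. b * f1 x = 0" using finite_states
    by (subst (asm) sum_nonneg_eq_0_iff) auto
  thus "step f2 x = f2 x" if "x \<in> S" for x using that f2[of x] by auto
qed fact+

lemma second_eigenvalue_le: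
  assumes "card S \<ge> 2"
  shows "eigenvalues_desc (transition_matrix S K) ! 1 \<le> 1 - 1 / T"
proof -
  define xs where "xs = (SOME xs. distinct xs \<and> set xs = S)"
  have "distinct xs \<and> set xs = S"
    unfolding xs_def by (rule someI_ex) (use finite_distinct_list[OF finite_states] in blast)
  hence xs: "distinct xs" "set xs = S" by auto
  define n where "n = length xs"
  have n2: "n \<ge> 2" using assms xs distinct_card by (fastforce simp: n_def)
  define A where "A = transition_matrix S K"
  have A_eq: "A = Matrix.mat n n (\<lambda>(i, j). pmf (K (xs ! i)) (xs ! j))"
    by (simp add: A_def transition_matrix_def xs_def n_def Let_def)
  have A: "A \<in> carrier_mat n n" by (simp add: A_eq)
  have xsS: "xs ! i \<in> S" if "i < n" for i using that xs by (auto simp: n_def)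
  have sum_S: "(\<Sum>x\<in>S. g x) = (\<Sum>i<n. g (xs ! i))" for g :: "'a \<Rightarrow> real"
    unfolding n_def
    by (rule sum.reindex_bij_betw[symmetric]) (use xs bij_betw_nth in blast)
  \<comment> \<open>Vectors correspond to functions on the states along the enumeration.\<close>
  have fn: "\<exists>f. \<forall>i<n. f (xs ! i) = w i" for w :: "nat \<Rightarrow> real"
  proof -
    have inj: "inj_on ((!) xs) {..<n}" unfolding n_def by (rule inj_on_nth) (use xs in auto)
    have "\<forall>i<n. w (inv_into {..<n} ((!) xs) (xs ! i)) = w i"
      using inv_into_f_f[OF inj] by auto
    thus ?thesis by (intro exI[of _ "\<lambda>x. w (inv_into {..<n} ((!) xs) x)"])
  qed
  have step_xs: "step f (xs ! i) = (\<Sum>j<n. A $$ (i, j) * w j)"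
    if "\<forall>i<n. f (xs ! i) = w i" "i < n" for f w i
    using that by (simp add: step_def sum_S A_eq)
  obtain es where es: "char_poly A = (\<Prod>e\<leftarrow>es. [:- e, 1:])" "length es = n"
    using real_symmetric_char_poly_splits[OF A] by (auto simp: A_eq symmetric xsS)
  define ds where "ds = rev (sort es)"
  have desc: "eigenvalues_desc A = ds"
    unfolding ds_def by (rule eigenvalues_desc_linear_factors[OF es(1)])
  have len: "length ds = n" by (simp add: ds_def es)
  have cp: "char_poly A = (\<Prod>e\<leftarrow>ds. [:- e, 1:])"
  proof -
    have "mset (map (\<lambda>e. [:- e, 1:]) ds) = mset (map (\<lambda>e. [:- e, 1:]) es)"
      by (simp add: ds_def)
    thus ?thesis unfolding es(1) by (metis prod_mset_prod_list)
  qed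
  have ev_cases: "e = 1 \<or> e \<le> 1 - 1 / T" if "e \<in> set ds" for e
  proof -
    have "poly (char_poly A) e = 0" unfolding cp using that by (induction ds) auto
    hence "eigenvalue A e" using eigenvalue_root_char_poly[OF A] by simp
    then obtain v where v: "v \<in> carrier_vec n" "v \<noteq> 0\<^sub>v n" "A *\<^sub>v v = e \<cdot>\<^sub>v v"
      using A by (auto simp: eigenvalue_def eigenvector_def)
    obtain i where i: "i < n" "v $ i \<noteq> 0"
      using v by (metis carrier_vecD eq_vecI index_zero_vec(1) index_zero_vec(2))
    obtain f where f: "\<forall>i<n. f (xs ! i) = v $ i" using fn by blast
    have "step f (xs ! i) = e * f (xs ! i)" if "i < n" for i
    proof -
      have "(A *\<^sub>v v) $ i = (\<Sum>j<n. A $$ (i, j) * v $ j)"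
        using that A v(1) by (simp add: scalar_prod_def lessThan_atLeast0)
      thus ?thesis using v that f step_xs[OF f that] by simp
    qed
    hence "step f x = e * f x" if "x \<in> S" for x
      using that xs by (metis in_set_conv_nth n_def)
    thus ?thesis using eigenvalue_le[of f e "xs ! i"] i f xsS by auto
  qed
  show ?thesis
  proof (rule ccontr)
    assume "\<not> ?thesis"
    hence "ds ! 1 > 1 - 1 / T" by (simp add: A_def[symmetric] desc)
    hence d1: "ds ! 1 = 1" using ev_cases[of "ds ! 1"] len n2 by auto
    have "ds ! 1 \<le> ds ! 0"
    proof -
      have "sort es ! (n - 2) \<le> sort es ! (n - 1)"
        using es n2 by (intro sorted_nth_mono) auto
      thus ?thesis using es n2 by (simp add: ds_def rev_nth numeral_2_eq_2)
    qed
    hence "ds ! 0 = 1"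
      using ev_cases[of "ds ! 0"] len n2 d1 T_pos
      by (smt (verit) le_trans nth_mem one_le_numeral less_le_trans zero_less_divide_1_iff zero_less_numeral)
    obtain B P Q where BPQ: "schur_decomposition A ds = (B, P, Q)"
      by (metis prod_cases3)
    from schur_decomposition[OF A cp BPQ]
    have wit: "similar_mat_wit A B P Q" and ut: "upper_triangular B" and diag: "diag_mat B = ds"
      by auto
    from similar_mat_witD2[OF A wit] have QP: "Q * P = 1\<^sub>m n" and APBQ: "A = P * B * Q"
      and B: "B \<in> carrier_mat n n" and P: "P \<in> carrier_mat n n" and Q: "Q \<in> carrier_mat n n"
      by auto
    have "A * P = P * B * (Q * P)"
      unfolding APBQ using B P Q by (simp add: assoc_mult_mat[of _ n n _ n _ n])
    hence AP: "A * P = P * B" using B P by (simp add: QP)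
    \<comment> \<open>The first two columns of \<open>P\<close> span an invariant plane on which the matrix is unipotent, so both
      are constant vectors, which contradicts the invertibility of \<open>P\<close>.\<close>
    have prod_nth: "(M * N) $$ (i, j) = (\<Sum>l<n. M $$ (i, l) * N $$ (l, j))"
      if "M \<in> carrier_mat n n" "N \<in> carrier_mat n n" "i < n" "j < n" for M N :: "real mat" and i j
      using that by (simp add: scalar_prod_def lessThan_atLeast0)
    have B00: "B $$ (0, 0) = 1" and B11: "B $$ (1, 1) = 1"
      using diag \<open>ds ! 0 = 1\<close> d1 B n2 by (auto simp: diag_mat_def)
    have Blow: "B $$ (l, j) = 0" if "j < l" "l < n" for l j
      using ut that B by auto
    have col0: "(\<Sum>l<n. A $$ (i, l) * P $$ (l, 0)) = P $$ (i, 0)" if "i < n" for i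
    proof -
      have "(\<Sum>l<n. P $$ (i, l) * B $$ (l, 0)) = (\<Sum>l\<in>{0}. P $$ (i, l) * B $$ (l, 0))"
        by (rule sum.mono_neutral_right) (use n2 Blow in auto)
      thus ?thesis using prod_nth[of A P i 0] prod_nth[of P B i 0] AP A B P that n2 B00 by simp
    qed
    have col1: "(\<Sum>l<n. A $$ (i, l) * P $$ (l, 1)) = P $$ (i, 1) + B $$ (0, 1) * P $$ (i, 0)"
      if "i < n" for i
    proof -
      have "(\<Sum>l<n. P $$ (i, l) * B $$ (l, 1)) = (\<Sum>l\<in>{0, 1}. P $$ (i, l) * B $$ (l, 1))"
        by (rule sum.mono_neutral_right) (use n2 Blow in auto)
      thus ?thesis using prod_nth[of A P i 1] prod_nth[of P B i 1] AP A B P that n2 B11 by simp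
    qed
    obtain f1 where f1: "\<forall>i<n. f1 (xs ! i) = P $$ (i, 0)" using fn[of "\<lambda>i. P $$ (i, 0)"] by blast
    obtain f2 where f2: "\<forall>i<n. f2 (xs ! i) = P $$ (i, 1)" using fn[of "\<lambda>i. P $$ (i, 1)"] by blast
    have s1: "step f1 x = f1 x" if "x \<in> S" for x
    proof -
      from that obtain i where i: "i < n" "x = xs ! i" using xs by (auto simp: in_set_conv_nth n_def)
      show ?thesis using step_xs[OF f1 i(1)] col0[OF i(1)] f1 i by simp
    qed
    have s2: "step f2 x = f2 x + B $$ (0, 1) * f1 x" if "x \<in> S" for x
    proof -
      from that obtain i where i: "i < n" "x = xs ! i" using xs by (auto simp: in_set_conv_nth n_def)
      show ?thesis using step_xs[OF f2 i(1)] col1[OF i(1)] f1 f2 i by simp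
    qed
    have c1: "P $$ (i, 0) = P $$ (0, 0)" if "i < n" for i
      using step_fixed_imp_constant[OF s1 xsS[OF that] xsS[of 0]] f1 that n2 by simp
    have c2: "P $$ (i, 1) = P $$ (0, 1)" if "i < n" for i
      using generalized_eigenvector_constant[OF s1 s2 xsS[OF that] xsS[of 0]] f2 that n2 by simp
    have "(\<Sum>l<n. Q $$ (i, l)) * P $$ (0, j) = 1\<^sub>m n $$ (i, j)" if "i < n" "j = 0 \<or> j = 1" for i j
    proof -
      have "(\<Sum>l<n. Q $$ (i, l) * P $$ (l, j)) = (\<Sum>l<n. Q $$ (i, l) * P $$ (0, j))"
        using c1 c2 that(2) by (intro sum.cong) auto
      thus ?thesis using prod_nth[OF Q P that(1), of j] QP that n2 by (auto simp: sum_distrib_right)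
    qed
    from this[of 0 0] this[of 0 1] this[of 1 1] n2 show False by auto
  qed
qed

lemma relaxation_time_le:
  assumes "card S \<ge> 2"
  shows "relaxation_time S K \<le> ennreal T"
proof -
  have gap: "spectral_gap S K \<ge> 1 / T"
    using second_eigenvalue_le[OF assms] by (simp add: spectral_gap_def)
  hence pos: "spectral_gap S K > 0" using T_pos
    by (meson less_le_trans zero_less_divide_1_iff)
  have "inverse (spectral_gap S K) \<le> T"
    using gap pos T_pos by (simp add: field_simps)
  thus ?thesis using pos by (simp add: relaxation_time_def inverse_ennreal ennreal_leI)
qed

text \<open>For a lazy chain \<open>P - P\<^sup>2\<close> is positive semidefinite. This replaces a
  lower bound on the spectrum.\<close>

lemma sum_step_squares_le_lazy:
  assumes lazy: "\<And>x. x \<in> S \<Longrightarrow> pmf (K x) x \<ge> 1 / 2"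
  shows "(\<Sum>x\<in>S. (step f x)\<^sup>2) \<le> (\<Sum>x\<in>S. f x * step f x)"
proof -
  \<comment> \<open>By laziness \<open>2 P - 1\<close> is a doubly stochastic matrix and therefore an \<open>L\<^sup>2\<close> contraction.\<close>
  define q where "q x y = 2 * pmf (K x) y - (if x = y then 1 else 0)" for x y
  define g where "g x = 2 * step f x - f x" for x
  have q_nonneg: "q x y \<ge> 0" if "x \<in> S" for x y
    using lazy[OF that] by (auto simp: q_def)
  have q_row: "(\<Sum>y\<in>S. q x y) = 1" if "x \<in> S" for x
    using that finite_states by (simp add: q_def sum_subtractf sum_distrib_left[symmetric] row_sum)
  have q_col: "(\<Sum>x\<in>S. q x y) = 1" if "y \<in> S" for y
    using that finite_states by (simp add: q_def sum_subtractf sum_distrib_left[symmetric] column_sum)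
  have q_g: "(\<Sum>y\<in>S. q x y * f y) = g x" if "x \<in> S" for x
    using that finite_states
    by (simp add: q_def g_def step_def sum_subtractf left_diff_distrib sum_distrib_left mult.assoc if_distrib[of "\<lambda>z. z * _"] cong: if_cong)
  have jensen: "(g x)\<^sup>2 \<le> (\<Sum>y\<in>S. q x y * (f y)\<^sup>2)" if "x \<in> S" for x
  proof -
    have "0 \<le> (\<Sum>y\<in>S. q x y * (f y - g x)\<^sup>2)"
      by (intro sum_nonneg mult_nonneg_nonneg q_nonneg that) auto
    also have "\<dots> = (\<Sum>y\<in>S. q x y * (f y)\<^sup>2) - 2 * g x * (\<Sum>y\<in>S. q x y * f y) + (g x)\<^sup>2 * (\<Sum>y\<in>S. q x y)"
      unfolding sum_distrib_left sum_subtractf[symmetric] sum.distrib[symmetric]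
      by (intro sum.cong refl) (simp add: power2_eq_square algebra_simps)
    finally show ?thesis using q_g[OF that] q_row[OF that] by (simp add: power2_eq_square)
  qed
  have "(\<Sum>x\<in>S. (g x)\<^sup>2) \<le> (\<Sum>x\<in>S. \<Sum>y\<in>S. q x y * (f y)\<^sup>2)"
    by (intro sum_mono jensen)
  also have "\<dots> = (\<Sum>y\<in>S. (\<Sum>x\<in>S. q x y) * (f y)\<^sup>2)"
    by (subst sum.swap) (simp add: sum_distrib_right)
  also have "\<dots> = (\<Sum>x\<in>S. (f x)\<^sup>2)" by (simp add: q_col)
  also have "(\<Sum>x\<in>S. (g x)\<^sup>2) = 4 * (\<Sum>x\<in>S. (step f x)\<^sup>2) - 4 * (\<Sum>x\<in>S. f x * step f x) + (\<Sum>x\<in>S. (f x)\<^sup>2)"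
    unfolding g_def sum_distrib_left sum_subtractf[symmetric] sum.distrib[symmetric]
    by (intro sum.cong refl) (simp add: power2_eq_square algebra_simps)
  finally show ?thesis by simp
qed

lemma set_pmf_step_distribution:
  assumes "x \<in> S" shows "set_pmf (step_distribution K t x) \<subseteq> S"
proof (induction t)
  case 0
  then show ?case using assms by (simp add: step_distribution_def)
next
  case (Suc t)
  then show ?case using set_pmf_subset by (fastforce simp: step_distribution_def)
qed

lemma pmf_step_distribution_Suc:
  assumes "x \<in> S" "y \<in> S"
  shows "pmf (step_distribution K (Suc t) x) y = step (pmf (step_distribution K t x)) y"
proof -
  have "pmf (step_distribution K (Suc t) x) y =
      (\<integral>z. pmf (K z) y \<partial>measure_pmf (step_distribution K t x))"
    by (simp add: step_distribution_def pmf_bind)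
  also have "\<dots> = (\<Sum>z\<in>S. pmf (K z) y * pmf (step_distribution K t x) z)"
    using set_pmf_step_distribution[OF assms(1)] finite_states
    by (intro integral_measure_pmf_real) auto
  also have "\<dots> = (\<Sum>z\<in>S. pmf (K y) z * pmf (step_distribution K t x) z)"
    using assms by (intro sum.cong refl) (simp add: symmetric)
  finally show ?thesis by (simp add: step_def)
qed

lemma l2_distance_le:
  assumes lazy: "\<And>x. x \<in> S \<Longrightarrow> pmf (K x) x \<ge> 1 / 2" and "T \<ge> 1" and x: "x \<in> S"
  shows "(\<Sum>y\<in>S. (pmf (step_distribution K t x) y - 1 / card S)\<^sup>2) \<le> (1 - 1 / T) ^ t"
proof (induction t)
  case 0
  have N: "real (card S) > 0" using x finite_states by (auto simp: card_gt_0_iff)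
  have "(\<Sum>y\<in>S. (pmf (step_distribution K 0 x) y - 1 / card S)\<^sup>2) =
     (\<Sum>y\<in>S. (if y = x then 1 - 2 / card S else 0) + (1 / card S)\<^sup>2)"
    by (intro sum.cong refl) (auto simp: step_distribution_def power2_eq_square algebra_simps)
  also have "\<dots> = 1 - 1 / card S"
    using x finite_states N by (simp add: sum.distrib power2_eq_square)
  finally show ?case by simp
next
  case (Suc t)
  define h where "h y = pmf (step_distribution K t x) y - 1 / card S" for y
  have N: "real (card S) > 0" using x finite_states by (auto simp: card_gt_0_iff)
  have h_sum: "(\<Sum>y\<in>S. h y) = 0"
    using sum_pmf_eq_1[OF finite_states set_pmf_step_distribution[OF x], of t] N
    by (simp add: h_def sum_subtractf)
  have eq: "pmf (step_distribution K (Suc t) x) y - 1 / card S = step h y" if "y \<in> S" for y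
    using pmf_step_distribution_Suc[OF x that, of t] row_sum[OF that]
    by (simp add: step_def h_def right_diff_distrib sum_subtractf sum_distrib_right[symmetric]
        sum_divide_distrib[symmetric])
  have "(\<Sum>y\<in>S. (pmf (step_distribution K (Suc t) x) y - 1 / card S)\<^sup>2) = (\<Sum>y\<in>S. (step h y)\<^sup>2)"
    by (intro sum.cong refl) (simp add: eq)
  also have "\<dots> \<le> (\<Sum>y\<in>S. h y * step h y)" by (rule sum_step_squares_le_lazy[OF lazy])
  also have "\<dots> \<le> (1 - 1 / T) * (\<Sum>y\<in>S. (h y)\<^sup>2)" by (rule step_mean_zero_le[OF h_sum])
  also have "\<dots> \<le> (1 - 1 / T) * (1 - 1 / T) ^ t"
    using Suc \<open>T \<ge> 1\<close> by (intro mult_left_mono) (auto simp: h_def)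
  finally show ?case by simp
qed

lemma tv_distance_le_quarter:
  assumes lazy: "\<And>x. x \<in> S \<Longrightarrow> pmf (K x) x \<ge> 1 / 2" and "T \<ge> 1" and "S \<noteq> {}"
    and t: "real t \<ge> T * ln (4 * card S)"
  shows "tv_distance S K (pmf_of_set S) t \<le> 1 / 4"
proof -
  have N: "real (card S) > 0" using assms(3) finite_states by (simp add: card_gt_0_iff)
  have "1 - 1 / T \<le> exp (- (1 / T))" using exp_ge_add_one_self[of "- (1 / T)"] by simp
  hence "(1 - 1 / T) ^ t \<le> exp (- (1 / T)) ^ t" using \<open>T \<ge> 1\<close> by (intro power_mono) auto
  also have "\<dots> = exp (- (t / T))" by (simp add: exp_of_nat_mult[symmetric])
  also have "\<dots> \<le> exp (- ln (4 * card S))" using t T_pos by (simp add: field_simps)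
  also have "\<dots> = 1 / (4 * card S)" using N by (simp add: exp_minus field_simps)
  finally have r: "(1 - 1 / T) ^ t \<le> 1 / (4 * card S)" .
  have "1 / 2 * (\<Sum>y\<in>S. \<bar>pmf (step_distribution K t x) y - pmf (pmf_of_set S) y\<bar>) \<le> 1 / 4"
    if "x \<in> S" for x
  proof -
    let ?h = "\<lambda>y. \<bar>pmf (step_distribution K t x) y - pmf (pmf_of_set S) y\<bar>"
    have "(\<Sum>y\<in>S. ?h y)\<^sup>2 \<le> (\<Sum>y\<in>S. (?h y)\<^sup>2) * card S"
      by (rule sum_squared_le_sum_of_squares)
    also have "(\<Sum>y\<in>S. (?h y)\<^sup>2) = (\<Sum>y\<in>S. (pmf (step_distribution K t x) y - 1 / card S)\<^sup>2)"
      using finite_states assms(3) by (intro sum.cong refl) simp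
    also have "\<dots> * card S \<le> 1 / (4 * card S) * card S"
      using l2_distance_le[OF lazy \<open>T \<ge> 1\<close> that, of t] r by (intro mult_right_mono) auto
    also have "\<dots> = (1 / 2)\<^sup>2" using N by (simp add: power2_eq_square)
    finally have "(\<Sum>y\<in>S. ?h y) \<le> 1 / 2" by (rule power2_le_imp_le) simp
    thus ?thesis by simp
  qed
  thus ?thesis unfolding tv_distance_def using finite_states assms(3)
    by (subst Max_le_iff) auto
qed

lemma mixing_time_le:
  assumes lazy: "\<And>x. x \<in> S \<Longrightarrow> pmf (K x) x \<ge> 1 / 2" and "T \<ge> 1" and "S \<noteq> {}"
  shows "ennreal_of_enat (mixing_time S K (pmf_of_set S) (1 / 4)) \<le> ennreal (T * ln (4 * card S) + 1)"
proof -
  define t where "t = nat \<lceil>T * ln (4 * card S)\<rceil>"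
  have N: "real (card S) \<ge> 1"
    using assms(3) finite_states by (simp add: card_gt_0_iff Suc_le_eq)
  hence nonneg: "T * ln (4 * card S) \<ge> 0" using T_pos by simp
  have "mixing_time S K (pmf_of_set S) (1 / 4) \<le> enat t"
    unfolding mixing_time_def
  proof (rule INF_lower, safe)
    fix t' assume "t \<le> t'"
    thus "tv_distance S K (pmf_of_set S) t' \<le> 1 / 4"
      by (intro tv_distance_le_quarter[OF assms]) (auto simp: t_def)
  qed
  hence "ennreal_of_enat (mixing_time S K (pmf_of_set S) (1 / 4)) \<le> ennreal_of_enat (enat t)"
    by (simp only: ennreal_of_enat_le_iff)
  also have "\<dots> = ennreal (real t)" by (simp add: ennreal_of_nat_eq_real_of_nat)
  also have "\<dots> \<le> ennreal (T * ln (4 * card S) + 1)"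
    using nonneg unfolding t_def by (intro ennreal_leI) linarith
  finally show ?thesis .
qed

end

section \<open>Dyadic tilings encoded by bit lists\<close>

text \<open>A bit list encodes the dyadic interval that is reached from \<open>[0, 1]\<close> by
  passing successively to the lower (\<^const>\<open>False\<close>) or upper
  (\<^const>\<open>True\<close>) half, the head being the first choice. A tile is a pair of such
  lists, for its projections to the two axes. Intervals of two bit lists have disjoint interiors iff
  neither list is a prefix of the other.\<close>

type_synonym tile = "bool list \<times> bool list"

definition nonoverlap :: "tile \<Rightarrow> tile \<Rightarrow> bool" where
  "nonoverlap p q \<longleftrightarrow> fst p \<parallel> fst q \<or> snd p \<parallel> snd q"

text \<open>Sets of non-overlapping dyadic rectangles of area \<open>1 / 2 ^ k\<close>. A packing is
  a tiling iff it has the maximal number \<open>2 ^ k\<close> of elements, so that covering of the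
  square need not be mentioned.\<close>

definition packing :: "nat \<Rightarrow> tile set \<Rightarrow> bool" where
  "packing k \<sigma> \<longleftrightarrow> finite \<sigma> \<and> (\<forall>p\<in>\<sigma>. length (fst p) + length (snd p) = k) \<and>
     (\<forall>p\<in>\<sigma>. \<forall>q\<in>\<sigma>. p \<noteq> q \<longrightarrow> nonoverlap p q)"

definition tilings :: "nat \<Rightarrow> tile set set" where
  "tilings k = {\<sigma>. packing k \<sigma> \<and> card \<sigma> = 2 ^ k}"

text \<open>The tilings with left half \<open>\<sigma>\<close> and right half \<open>\<tau>\<close>,
  respectively with lower half \<open>\<sigma>\<close> and upper half \<open>\<tau>\<close>, both
  halves being scaled copies of the unit square.\<close>

definition join_x :: "tile set \<Rightarrow> tile set \<Rightarrow> tile set" where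
  "join_x \<sigma> \<tau> = apfst (Cons False) ` \<sigma> \<union> apfst (Cons True) ` \<tau>"

definition join_y :: "tile set \<Rightarrow> tile set \<Rightarrow> tile set" where
  "join_y \<sigma> \<tau> = apsnd (Cons False) ` \<sigma> \<union> apsnd (Cons True) ` \<tau>"

text \<open>Reflection in the diagonal, which exchanges the two coordinates.\<close>

abbreviation transp :: "tile set \<Rightarrow> tile set" where
  "transp \<sigma> \<equiv> prod.swap ` \<sigma>"

lemma parallel_Cons: "a # u \<parallel> b # v \<longleftrightarrow> a \<noteq> b \<or> u \<parallel> v"
  by (auto simp: parallel_def)

lemma parallel_irrefl [simp]: "\<not> u \<parallel> u"
  by (simp add: parallel_def)

lemma nonoverlap_sym: "nonoverlap p q \<Longrightarrow> nonoverlap q p"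
  by (auto simp: nonoverlap_def parallel_commute)

lemma nonoverlap_swap: "nonoverlap (prod.swap p) (prod.swap q) \<longleftrightarrow> nonoverlap p q"
  by (auto simp: nonoverlap_def)

lemma transp_transp [simp]: "transp (transp \<sigma>) = \<sigma>"
  by (simp add: image_image)

lemma packing_transp: "packing k \<sigma> \<Longrightarrow> packing k (transp \<sigma>)"
  by (simp add: packing_def nonoverlap_swap add.commute inj_eq[OF inj_swap])

lemma card_transp [simp]: "card (transp \<sigma>) = card \<sigma>"
  by (rule card_image) (auto simp: inj_on_def)

lemma transp_tilings: "\<sigma> \<in> tilings k \<Longrightarrow> transp \<sigma> \<in> tilings k"
  by (simp add: tilings_def packing_transp)

lemma join_y_eq_transp: "join_y \<sigma> \<tau> = transp (join_x (transp \<sigma>) (transp \<tau>))"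
proof -
  have "prod.swap (apfst f (prod.swap p)) = apsnd f p" for f :: "bool list \<Rightarrow> bool list" and p :: tile
    by (cases p) simp
  thus ?thesis by (simp add: join_x_def join_y_def image_Un image_image)
qed

lemma packing_join_x:
  assumes "packing k \<sigma>" "packing k \<tau>"
  shows "packing (Suc k) (join_x \<sigma> \<tau>)"
proof -
  have "nonoverlap p q" if pq: "p \<in> join_x \<sigma> \<tau>" "q \<in> join_x \<sigma> \<tau>" "p \<noteq> q" for p q
  proof -
    have ex: "\<exists>b p'. p = apfst (Cons b) p' \<and> p' \<in> (if b then \<tau> else \<sigma>)" if "p \<in> join_x \<sigma> \<tau>" for p
    proof -
      from that consider p' where "p = apfst (Cons False) p'" "p' \<in> \<sigma>"
        | p' where "p = apfst (Cons True) p'" "p' \<in> \<tau>"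
        unfolding join_x_def by blast
      thus ?thesis
      proof cases
        case 1 thus ?thesis by (intro exI[of _ False] exI[of _ p']) simp
      next
        case 2 thus ?thesis by (intro exI[of _ True] exI[of _ p']) simp
      qed
    qed
    obtain b p' where p: "p = apfst (Cons b) p'" "p' \<in> (if b then \<tau> else \<sigma>)" using ex[OF pq(1)] by blast
    obtain c q' where q: "q = apfst (Cons c) q'" "q' \<in> (if c then \<tau> else \<sigma>)" using ex[OF pq(2)] by blast
    note * = p q
    show ?thesis
    proof (cases "b = c")
      case True
      hence "nonoverlap p' q'" using * assms pq(3) by (auto simp: packing_def split: if_splits)
      thus ?thesis using * by (cases p'; cases q') (auto simp: nonoverlap_def parallel_Cons)
    next
      case False
      thus ?thesis using * by (cases p'; cases q') (auto simp: nonoverlap_def parallel_Cons)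
    qed
  qed
  thus ?thesis using assms by (auto simp: packing_def join_x_def)
qed

lemma card_join_x:
  assumes "finite \<sigma>" "finite \<tau>"
  shows "card (join_x \<sigma> \<tau>) = card \<sigma> + card \<tau>"
proof -
  have inj: "inj_on (apfst (Cons b)) A" for b :: bool and A :: "tile set"
    by (auto simp: inj_on_def)
  show ?thesis unfolding join_x_def using assms
    by (subst card_Un_disjoint) (auto simp: card_image[OF inj])
qed

lemma join_x_tilings:
  assumes "\<sigma> \<in> tilings k" "\<tau> \<in> tilings k"
  shows "join_x \<sigma> \<tau> \<in> tilings (Suc k)"
  using assms by (simp add: tilings_def packing_join_x card_join_x packing_def[of k])

lemma join_y_tilings:
  assumes "\<sigma> \<in> tilings k" "\<tau> \<in> tilings k"
  shows "join_y \<sigma> \<tau> \<in> tilings (Suc k)"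
  unfolding join_y_eq_transp using assms by (intro transp_tilings join_x_tilings)

lemma packing_split_x:
  assumes "packing (Suc k) \<sigma>" "\<And>p. p \<in> \<sigma> \<Longrightarrow> fst p \<noteq> []"
  obtains \<sigma>1 \<sigma>2 where "packing k \<sigma>1" "packing k \<sigma>2" "\<sigma> = join_x \<sigma>1 \<sigma>2"
proof -
  define half where "half b = apfst (Cons b) -` \<sigma>" for b
  have inj: "inj (apfst (Cons b) :: tile \<Rightarrow> tile)" for b by (auto simp: inj_def)
  have "packing k (half b)" for b
  proof -
    have "finite (half b)" unfolding half_def
      using assms(1) inj by (intro finite_vimageI) (auto simp: packing_def)
    moreover have "length (fst p) + length (snd p) = k" if "p \<in> half b" for p
    proof -
      have "apfst (Cons b) p \<in> \<sigma>" using that by (simp add: half_def)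
      hence "length (fst (apfst (Cons b) p)) + length (snd (apfst (Cons b) p)) = Suc k"
        using assms(1) unfolding packing_def by blast
      thus ?thesis by simp
    qed
    moreover have "nonoverlap p q" if "p \<in> half b" "q \<in> half b" "p \<noteq> q" for p q
    proof -
      have "nonoverlap (apfst (Cons b) p) (apfst (Cons b) q)"
        using assms(1) that inj_eq[OF inj] by (simp add: half_def packing_def)
      thus ?thesis by (cases p; cases q) (simp add: nonoverlap_def parallel_Cons)
    qed
    ultimately show ?thesis by (simp add: packing_def)
  qed
  moreover have "\<sigma> = join_x (half False) (half True)"
  proof (rule subset_antisym; rule subsetI)
    fix p assume p: "p \<in> \<sigma>"
    then obtain b u where "fst p = b # u" using assms(2) by (meson neq_Nil_conv)
    hence eq: "apfst (Cons b) (u, snd p) = p" by (cases p) simp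
    hence "(u, snd p) \<in> half b" using p by (simp add: half_def)
    hence "p \<in> apfst (Cons b) ` half b" by (metis eq imageI)
    thus "p \<in> join_x (half False) (half True)" unfolding join_x_def by (cases b) simp_all
  qed (auto simp: join_x_def half_def)
  ultimately show ?thesis using that by blast
qed

text \<open>A tile with an empty first (second) list has full width (height). Tiles of both kinds
  cannot occur together, because any two such tiles overlap.\<close>

lemma packing_split:
  assumes "packing (Suc k) \<sigma>"
  shows "\<exists>\<sigma>1 \<sigma>2. packing k \<sigma>1 \<and> packing k \<sigma>2 \<and> (\<sigma> = join_x \<sigma>1 \<sigma>2 \<or> \<sigma> = join_y \<sigma>1 \<sigma>2)"
proof (cases "\<forall>p\<in>\<sigma>. fst p \<noteq> []")
  case True
  thus ?thesis using packing_split_x[OF assms] by metis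
next
  case False
  then obtain v where v: "([], v) \<in> \<sigma>" by auto
  have "snd p \<noteq> []" if "p \<in> \<sigma>" for p
  proof
    assume "snd p = []"
    with v that assms have "p = ([], v)"
      unfolding packing_def nonoverlap_def by (metis fst_conv parallel_Nil1 parallel_Nil2)
    thus False using \<open>snd p = []\<close> that assms unfolding packing_def by auto
  qed
  hence "fst p \<noteq> []" if "p \<in> transp \<sigma>" for p using that by auto
  from packing_split_x[OF packing_transp[OF assms] this]
  obtain \<sigma>1 \<sigma>2 where *: "packing k \<sigma>1" "packing k \<sigma>2" "transp \<sigma> = join_x \<sigma>1 \<sigma>2" by metis
  have "\<sigma> = join_y (transp \<sigma>1) (transp \<sigma>2)"
    using *(3) by (metis join_y_eq_transp transp_transp)
  thus ?thesis using * packing_transp by blast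
qed

lemma card_join_y:
  assumes "finite \<sigma>" "finite \<tau>"
  shows "card (join_y \<sigma> \<tau>) = card \<sigma> + card \<tau>"
  using assms by (simp add: join_y_eq_transp card_join_x)

lemma packing_card_le: "packing k \<sigma> \<Longrightarrow> card \<sigma> \<le> 2 ^ k"
proof (induction k arbitrary: \<sigma>)
  case 0
  hence "\<sigma> \<subseteq> {([], [])}" by (auto simp: packing_def)
  thus ?case using card_mono[of "{([], [])}" \<sigma>] by simp
next
  case (Suc k)
  then obtain \<sigma>1 \<sigma>2 where *: "packing k \<sigma>1" "packing k \<sigma>2" "\<sigma> = join_x \<sigma>1 \<sigma>2 \<or> \<sigma> = join_y \<sigma>1 \<sigma>2"
    using packing_split by blast
  moreover have "finite \<sigma>1" "finite \<sigma>2" using * by (auto simp: packing_def)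
  ultimately show ?case using Suc.IH[of \<sigma>1] Suc.IH[of \<sigma>2] by (auto simp: card_join_x card_join_y)
qed

lemma tilings_Suc:
  "tilings (Suc k) = case_prod join_x ` (tilings k \<times> tilings k) \<union> case_prod join_y ` (tilings k \<times> tilings k)"
proof
  show "tilings (Suc k) \<subseteq> case_prod join_x ` (tilings k \<times> tilings k) \<union> case_prod join_y ` (tilings k \<times> tilings k)"
  proof
    fix \<sigma> assume \<sigma>: "\<sigma> \<in> tilings (Suc k)"
    then obtain \<sigma>1 \<sigma>2 where *: "packing k \<sigma>1" "packing k \<sigma>2" "\<sigma> = join_x \<sigma>1 \<sigma>2 \<or> \<sigma> = join_y \<sigma>1 \<sigma>2"
      using packing_split unfolding tilings_def by blast
    have "finite \<sigma>1" "finite \<sigma>2" using * by (auto simp: packing_def)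
    hence "card \<sigma>1 + card \<sigma>2 = 2 * 2 ^ k" using * \<sigma> by (auto simp: card_join_x card_join_y tilings_def)
    hence "card \<sigma>1 = 2 ^ k" "card \<sigma>2 = 2 ^ k"
      using packing_card_le[OF *(1)] packing_card_le[OF *(2)] by auto
    thus "\<sigma> \<in> case_prod join_x ` (tilings k \<times> tilings k) \<union> case_prod join_y ` (tilings k \<times> tilings k)"
      using * by (auto simp: tilings_def image_iff)
  qed
qed (auto intro: join_x_tilings join_y_tilings)

lemma join_x_inject: "join_x \<sigma> \<tau> = join_x \<sigma>' \<tau>' \<longleftrightarrow> \<sigma> = \<sigma>' \<and> \<tau> = \<tau>'"
proof
  assume eq: "join_x \<sigma> \<tau> = join_x \<sigma>' \<tau>'"
  have "apfst (Cons False) -` join_x \<sigma> \<tau> = \<sigma>" "apfst (Cons True) -` join_x \<sigma> \<tau> = \<tau>" for \<sigma> \<tau>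
    by (auto simp: join_x_def apfst_def map_prod_def)
  thus "\<sigma> = \<sigma>' \<and> \<tau> = \<tau>'" using eq by metis
qed auto

lemma join_y_inject: "join_y \<sigma> \<tau> = join_y \<sigma>' \<tau>' \<longleftrightarrow> \<sigma> = \<sigma>' \<and> \<tau> = \<tau>'"
proof -
  have "transp \<sigma> = transp \<tau> \<longleftrightarrow> \<sigma> = \<tau>" for \<sigma> \<tau> by (metis transp_transp)
  thus ?thesis by (simp add: join_y_eq_transp join_x_inject)
qed

lemma join_x_join_y:
  "join_x (join_y a b) (join_y c d) = join_y (join_x a c) (join_x b d)"
  unfolding join_x_def join_y_def image_Un image_image apfst_apsnd apsnd_apfst
  by (simp only: Un_ac)

lemma tilings_0: "tilings 0 = {{([], [])}}"
proof -
  have "\<sigma> = {([], [])}" if "packing 0 \<sigma>" "card \<sigma> = 1" for \<sigma>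
    using that by (auto simp: packing_def card_1_singleton_iff)
  moreover have "packing 0 {([], [])}" by (simp add: packing_def)
  moreover have "card {([] :: bool list, [] :: bool list)} = 1" by simp
  ultimately have "packing 0 \<sigma> \<and> card \<sigma> = 2 ^ 0 \<longleftrightarrow> \<sigma> = {([], [])}" for \<sigma>
    unfolding power_0 by metis
  thus ?thesis by (simp only: tilings_def singleton_conv)
qed

lemma finite_tilings [simp]: "finite (tilings k)"
proof (induction k)
  case (Suc k) thus ?case by (simp add: tilings_Suc)
qed (simp add: tilings_0)

lemma tilings_nonempty: "tilings k \<noteq> {}"
proof (induction k)
  case (Suc k) thus ?case by (simp add: tilings_Suc)
qed (simp add: tilings_0)

lemma card_tilings_pos: "card (tilings k) > 0"
  using tilings_nonempty by (simp add: card_gt_0_iff)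

lemma card_joined:
  "card (case_prod join_x ` (tilings k \<times> tilings k)) = (card (tilings k))\<^sup>2"
  "card (case_prod join_y ` (tilings k \<times> tilings k)) = (card (tilings k))\<^sup>2"
  by (subst card_image; auto simp: inj_on_def join_x_inject join_y_inject power2_eq_square card_cartesian_product)+

lemma card_tilings_Suc_le: "card (tilings (Suc k)) \<le> 2 * (card (tilings k))\<^sup>2"
  unfolding tilings_Suc by (rule order_trans[OF card_Un_le]) (simp add: card_joined)

lemma card_tilings_le: "2 * card (tilings k) \<le> 2 ^ (2 ^ k)"
proof (induction k)
  case (Suc k)
  have "2 * card (tilings (Suc k)) \<le> (2 * card (tilings k))\<^sup>2"
    using card_tilings_Suc_le[of k] by (simp add: power2_eq_square)
  also have "\<dots> \<le> (2 ^ (2 ^ k))\<^sup>2" using Suc by (intro power_mono) auto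
  finally show ?case by (simp add: power_mult[symmetric] mult.commute)
qed (simp add: tilings_0)

text \<open>A tiling composed of four tilings of the quadrants is bisected in both
  directions.\<close>

lemma card_tilings_both_bisected:
  "(card (tilings k)) ^ 4 \<le> card (case_prod join_x ` (tilings (Suc k) \<times> tilings (Suc k)) \<inter>
     case_prod join_y ` (tilings (Suc k) \<times> tilings (Suc k)))"
proof -
  let ?\<Omega> = "tilings k"
  let ?q = "\<lambda>((a, b), (c, d)). join_x (join_y a b) (join_y c d)"
  have "card (?q ` ((?\<Omega> \<times> ?\<Omega>) \<times> (?\<Omega> \<times> ?\<Omega>))) = card ((?\<Omega> \<times> ?\<Omega>) \<times> (?\<Omega> \<times> ?\<Omega>))"
    by (rule card_image) (auto simp: inj_on_def join_x_inject join_y_inject)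
  also have "\<dots> = (card ?\<Omega>) ^ 4" by (simp add: card_cartesian_product power4_eq_xxxx)
  finally have card_q: "card (?q ` ((?\<Omega> \<times> ?\<Omega>) \<times> (?\<Omega> \<times> ?\<Omega>))) = (card ?\<Omega>) ^ 4" .
  have "?q ` ((?\<Omega> \<times> ?\<Omega>) \<times> (?\<Omega> \<times> ?\<Omega>)) \<subseteq> case_prod join_x ` (tilings (Suc k) \<times> tilings (Suc k)) \<inter>
     case_prod join_y ` (tilings (Suc k) \<times> tilings (Suc k))"
  proof safe
    fix a b c d assume t: "a \<in> ?\<Omega>" "b \<in> ?\<Omega>" "c \<in> ?\<Omega>" "d \<in> ?\<Omega>"
    thus "join_x (join_y a b) (join_y c d) \<in> case_prod join_x ` (tilings (Suc k) \<times> tilings (Suc k))"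
      by (intro image_eqI[of _ _ "(join_y a b, join_y c d)"]) (auto intro: join_y_tilings)
    show "join_x (join_y a b) (join_y c d) \<in> case_prod join_y ` (tilings (Suc k) \<times> tilings (Suc k))"
      using t by (intro image_eqI[of _ _ "(join_x a c, join_x b d)"]) (auto intro: join_x_tilings simp: join_x_join_y)
  qed
  thus ?thesis unfolding card_q[symmetric] by (intro card_mono) simp_all
qed

lemma card_tilings_Suc_ge: "card (tilings (Suc k)) \<ge> 2"
proof -
  obtain \<sigma> where \<sigma>: "\<sigma> \<in> tilings k" using tilings_nonempty by blast
  have "\<sigma> \<noteq> {}" using \<sigma> by (auto simp: tilings_def)
  then obtain u v where uv: "(u, v) \<in> \<sigma>" by auto
  have "join_x \<sigma> \<sigma> \<noteq> join_y \<sigma> \<sigma>"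
  proof
    assume eq: "join_x \<sigma> \<sigma> = join_y \<sigma> \<sigma>"
    \<comment> \<open>A tile of \<open>join_x \<sigma> \<sigma>\<close> may have a first list longer than all those in \<open>\<sigma>\<close>, a tile of
      \<open>join_y \<sigma> \<sigma>\<close> may not.\<close>
    define m where "m = Max ((\<lambda>p. length (fst p)) ` \<sigma>)"
    have fin: "finite ((\<lambda>p. length (fst p)) ` \<sigma>)" using \<sigma> by (auto simp: tilings_def packing_def)
    then obtain p where p: "p \<in> \<sigma>" "length (fst p) = m"
      using Max_in[OF fin] uv unfolding m_def by (metis (no_types, lifting) empty_iff imageE image_is_empty)
    have "apfst (Cons False) p \<in> join_y \<sigma> \<sigma>" using p(1) unfolding eq[symmetric] join_x_def by blast
    then obtain q where "q \<in> \<sigma>" and fst_q: "fst (apfst (Cons False) p) = fst q"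
      unfolding join_y_def by (metis UnE fst_apsnd imageE)
    hence "Suc m \<in> (\<lambda>p. length (fst p)) ` \<sigma>" using p(2) by (intro image_eqI[of _ _ q]) (simp_all add: fst_q[symmetric])
    hence "Suc m \<le> m" unfolding m_def using fin by (rule Max_ge[rotated])
    thus False by simp
  qed
  moreover have "card {join_x \<sigma> \<sigma>, join_y \<sigma> \<sigma>} \<le> card (tilings (Suc k))"
    using \<sigma> by (intro card_mono) (auto intro: join_x_tilings join_y_tilings)
  ultimately show ?thesis by simp
qed

section \<open>Poincare inequalities on products and on unions of two sets\<close>

text \<open>The sum of the squared differences of \<open>f\<close> over all pairs in \<open>A
  \<times> B\<close>; for \<open>A = B\<close> this is \<open>2 * (card A)\<^sup>2\<close> times the
  variance of \<open>f\<close> on \<open>A\<close>.\<close>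

definition sqd :: "('a \<Rightarrow> real) \<Rightarrow> 'a set \<Rightarrow> 'a set \<Rightarrow> real" where
  "sqd f A B = (\<Sum>x\<in>A. \<Sum>y\<in>B. (f x - f y)\<^sup>2)"

text \<open>The same sum over the ordered pairs of a relation \<open>R\<close> on \<open>A\<close>:
  an unnormalized Dirichlet form.\<close>

definition dirichlet :: "('a \<Rightarrow> 'a \<Rightarrow> bool) \<Rightarrow> ('a \<Rightarrow> real) \<Rightarrow> 'a set \<Rightarrow> real" where
  "dirichlet R f A = (\<Sum>x\<in>A. \<Sum>y\<in>A. if R x y then (f x - f y)\<^sup>2 else 0)"

lemma sqd_commute: "sqd f A B = sqd f B A"
  unfolding sqd_def by (subst sum.swap) (simp add: power2_commute)

lemma sqd_Un_left:
  "finite A \<Longrightarrow> finite B \<Longrightarrow> A \<inter> B = {} \<Longrightarrow> sqd f (A \<union> B) C = sqd f A C + sqd f B C"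
  by (simp add: sqd_def sum.union_disjoint)

lemma sqd_Un_right:
  "finite A \<Longrightarrow> finite B \<Longrightarrow> A \<inter> B = {} \<Longrightarrow> sqd f C (A \<union> B) = sqd f C A + sqd f C B"
  by (simp add: sqd_commute[of f C] sqd_Un_left)

lemma sqd_nonneg: "sqd f A B \<ge> 0"
  by (simp add: sqd_def sum_nonneg)

lemma dirichlet_nonneg: "dirichlet R f A \<ge> 0"
  by (simp add: dirichlet_def sum_nonneg)

lemma dirichlet_mono:
  assumes "A \<subseteq> B" "finite B"
  shows "dirichlet R f A \<le> dirichlet R f B"
proof -
  let ?w = "\<lambda>x y. if R x y then (f x - f y)\<^sup>2 else 0"
  have "dirichlet R f A \<le> (\<Sum>x\<in>A. \<Sum>y\<in>B. ?w x y)"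
    unfolding dirichlet_def using assms by (intro sum_mono sum_mono2) auto
  also have "\<dots> \<le> dirichlet R f B"
    unfolding dirichlet_def using assms by (intro sum_mono2 sum_nonneg) auto
  finally show ?thesis .
qed

text \<open>The Efron-Stein inequality for two factors. It is the sum over all \<open>a, a', b,
  b'\<close> of the fact that the mixed difference \<open>f (a, b) - f (a', b) - f (a, b') + f (a',
  b')\<close> has a nonnegative square, which is a signed sum of the squares of the six plain
  differences.\<close>

lemma sqd_product_le:
  assumes "finite A" "finite B"
  shows "sqd f (A \<times> B) (A \<times> B) \<le>
    card B * (\<Sum>b\<in>B. sqd (\<lambda>a. f (a, b)) A A) + card A * (\<Sum>a\<in>A. sqd (\<lambda>b. f (a, b)) B B)"
proof -
  let ?Q = "\<lambda>h :: 'a \<Rightarrow> 'a \<Rightarrow> 'b \<Rightarrow> 'b \<Rightarrow> real. \<Sum>a\<in>A. \<Sum>a'\<in>A. \<Sum>b\<in>B. \<Sum>b'\<in>B. h a a' b b'"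
  have full: "sqd f (A \<times> B) (A \<times> B) = ?Q (\<lambda>a a' b b'. (f (a, b) - f (a', b'))\<^sup>2)"
  proof -
    have "sqd f (A \<times> B) (A \<times> B) = (\<Sum>a\<in>A. \<Sum>b\<in>B. \<Sum>a'\<in>A. \<Sum>b'\<in>B. (f (a, b) - f (a', b'))\<^sup>2)"
      by (simp add: sqd_def sum.cartesian_product')
    also have "\<dots> = ?Q (\<lambda>a a' b b'. (f (a, b) - f (a', b'))\<^sup>2)"
      by (rule sum.cong[OF refl], rule sum.swap)
    finally show ?thesis .
  qed
  have full': "?Q (\<lambda>a a' b b'. (f (a', b) - f (a, b'))\<^sup>2) = sqd f (A \<times> B) (A \<times> B)"
    unfolding full by (subst sum.swap) simp
  have left: "?Q (\<lambda>a a' b b'. (f (a, b) - f (a', b))\<^sup>2) = card B * (\<Sum>b\<in>B. sqd (\<lambda>a. f (a, b)) A A)"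
  proof -
    have "(\<Sum>b\<in>B. sqd (\<lambda>a. f (a, b)) A A) = (\<Sum>a\<in>A. \<Sum>b\<in>B. \<Sum>a'\<in>A. (f (a, b) - f (a', b))\<^sup>2)"
      unfolding sqd_def by (rule sum.swap)
    also have "\<dots> = (\<Sum>a\<in>A. \<Sum>a'\<in>A. \<Sum>b\<in>B. (f (a, b) - f (a', b))\<^sup>2)"
      by (rule sum.cong[OF refl], rule sum.swap)
    finally show ?thesis by (simp add: sum_distrib_left)
  qed
  have left': "?Q (\<lambda>a a' b b'. (f (a, b') - f (a', b'))\<^sup>2) = ?Q (\<lambda>a a' b b'. (f (a, b) - f (a', b))\<^sup>2)"
    by (rule sum.cong[OF refl], rule sum.cong[OF refl], rule sum.swap)
  have right: "?Q (\<lambda>a a' b b'. (f (a, b) - f (a, b'))\<^sup>2) = card A * (\<Sum>a\<in>A. sqd (\<lambda>b. f (a, b)) B B)"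
    by (simp add: sqd_def sum_distrib_left)
  have right': "?Q (\<lambda>a a' b b'. (f (a', b) - f (a', b'))\<^sup>2) = ?Q (\<lambda>a a' b b'. (f (a, b) - f (a, b'))\<^sup>2)"
    by (subst sum.swap) simp
  have "0 \<le> ?Q (\<lambda>a a' b b'. (f (a, b) - f (a', b) - f (a, b') + f (a', b'))\<^sup>2)"
    by (intro sum_nonneg) simp
  also have "\<dots> = ?Q (\<lambda>a a' b b'. (f (a, b) - f (a', b))\<^sup>2 + (f (a, b') - f (a', b'))\<^sup>2
      + (f (a, b) - f (a, b'))\<^sup>2 + (f (a', b) - f (a', b'))\<^sup>2
      - (f (a, b) - f (a', b'))\<^sup>2 - (f (a', b) - f (a, b'))\<^sup>2)"
    by (intro sum.cong refl) (simp add: power2_eq_square algebra_simps)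
  also have "\<dots> = 2 * (card B * (\<Sum>b\<in>B. sqd (\<lambda>a. f (a, b)) A A))
      + 2 * (card A * (\<Sum>a\<in>A. sqd (\<lambda>b. f (a, b)) B B)) - 2 * sqd f (A \<times> B) (A \<times> B)"
    by (simp only: sum.distrib sum_subtractf left' right' full' left right full[symmetric])
  finally show ?thesis by simp
qed

text \<open>Differences between a point of \<open>V - H\<close> and a point of \<open>H - V\<close>
  are averaged over an intermediate point in \<open>V \<inter> H\<close>.\<close>

lemma sqd_two_cover_le:
  assumes fin: "finite V" "finite H" and card_eq: "card V = card H"
  shows "card (V \<inter> H) * sqd f (V \<union> H) (V \<union> H) \<le> card (V \<union> H) * (sqd f V V + sqd f H H)"
proof -
  define M V' H' where "M = V \<inter> H" and "V' = V - H" and "H' = H - V"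
  have finM: "finite M" "finite V'" "finite H'" using fin by (auto simp: M_def V'_def H'_def)
  have V: "V = V' \<union> M" and H: "H = H' \<union> M" and VH: "V \<union> H = V' \<union> (H' \<union> M)"
    and disj: "V' \<inter> M = {}" "H' \<inter> M = {}" "V' \<inter> (H' \<union> M) = {}"
    by (auto simp: M_def V'_def H'_def)
  have cV: "card V = card V' + card M" unfolding V using finM disj by (intro card_Un_disjoint)
  have cH: "card H = card H' + card M" unfolding H using finM disj by (intro card_Un_disjoint)
  have cVH: "card (V \<union> H) = card V' + (card H' + card M)"
    unfolding VH using finM disj by (simp add: card_Un_disjoint)
  have a: "card H' = card V'" using cV cH card_eq by simp
  let ?S = "sqd f"
  have SV: "?S V V = ?S V' V' + 2 * ?S V' M + ?S M M"
    unfolding V using finM disj by (simp add: sqd_Un_left sqd_Un_right sqd_commute[of f M V'] sqd_commute[of f M H'])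
  have SH: "?S H H = ?S H' H' + 2 * ?S H' M + ?S M M"
    unfolding H using finM disj by (simp add: sqd_Un_left sqd_Un_right sqd_commute[of f M V'] sqd_commute[of f M H'])
  have SVH: "?S (V \<union> H) (V \<union> H) = ?S V V + ?S H H - ?S M M + 2 * ?S V' H'"
    unfolding SV SH VH using finM disj
    by (simp add: sqd_Un_left sqd_Un_right sqd_commute[of f M V'] sqd_commute[of f M H'] sqd_commute[of f H' V'])
  have cross: "card M * ?S V' H' \<le> 2 * card V' * (?S V' M + ?S H' M)"
  proof -
    have "card M * ?S V' H' = (\<Sum>x\<in>V'. \<Sum>y\<in>H'. \<Sum>z\<in>M. (f x - f y)\<^sup>2)"
      by (simp add: sqd_def sum_distrib_left)
    also have "\<dots> \<le> (\<Sum>x\<in>V'. \<Sum>y\<in>H'. \<Sum>z\<in>M. 2 * (f x - f z)\<^sup>2 + 2 * (f y - f z)\<^sup>2)"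
    proof (intro sum_mono)
      fix x y z
      have "0 \<le> (f x - f z + (f y - f z))\<^sup>2" by simp
      thus "(f x - f y)\<^sup>2 \<le> 2 * (f x - f z)\<^sup>2 + 2 * (f y - f z)\<^sup>2"
        by (simp add: power2_eq_square algebra_simps)
    qed
    also have "\<dots> = 2 * card H' * ?S V' M + 2 * card V' * ?S H' M"
      by (simp add: sum.distrib sqd_def sum_distrib_left mult_ac)
    finally show ?thesis by (simp add: a algebra_simps)
  qed
  have "card M * ?S (V \<union> H) (V \<union> H) \<le> card M * (?S V V + ?S H H) + 2 * (card M * ?S V' H')"
    unfolding SVH by (simp add: algebra_simps sqd_nonneg)
  also have "\<dots> \<le> card M * (?S V V + ?S H H) + 2 * card V' * (2 * ?S V' M + 2 * ?S H' M)"
    using cross by (simp add: algebra_simps)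
  also have "\<dots> \<le> card M * (?S V V + ?S H H) + 2 * card V' * (?S V V + ?S H H)"
  proof -
    have "2 * ?S V' M + 2 * ?S H' M \<le> ?S V V + ?S H H"
      unfolding SV SH using sqd_nonneg[of f V' V'] sqd_nonneg[of f H' H'] sqd_nonneg[of f M M] by simp
    thus ?thesis by (intro add_left_mono mult_left_mono) auto
  qed
  also have "\<dots> = card (V \<union> H) * (?S V V + ?S H H)"
    unfolding cVH a by (simp add: algebra_simps)
  finally show ?thesis by (simp add: M_def)
qed

text \<open>A Poincare inequality on \<open>B\<close> passes to the square of \<open>B\<close>,
  embedded by \<open>J\<close>, for any relation that contains the moves in a single
  coordinate.\<close>

lemma poincare_product:
  fixes c :: real
  assumes fin: "finite B" and c: "c \<ge> 0"
    and poincare: "\<And>f. sqd f B B \<le> c * dirichlet R f B"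
    and inj: "inj_on (case_prod J) (B \<times> B)"
    and left: "\<And>a a' b. R a a' \<Longrightarrow> R' (J a b) (J a' b)"
    and right: "\<And>a b b'. R b b' \<Longrightarrow> R' (J a b) (J a b')"
  shows "sqd f (case_prod J ` (B \<times> B)) (case_prod J ` (B \<times> B))
    \<le> card B * c * dirichlet R' f (case_prod J ` (B \<times> B))"
proof -
  define V where "V = case_prod J ` (B \<times> B)"
  define g where "g = f \<circ> case_prod J"
  let ?D = "dirichlet R"
  have "sqd f V V = sqd g (B \<times> B) (B \<times> B)"
    unfolding sqd_def V_def by (simp add: sum.reindex[OF inj] g_def)
  also have "\<dots> \<le> card B * (\<Sum>b\<in>B. sqd (\<lambda>a. g (a, b)) B B) + card B * (\<Sum>a\<in>B. sqd (\<lambda>b. g (a, b)) B B)"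
    by (rule sqd_product_le) (use fin in auto)
  also have "\<dots> \<le> card B * (\<Sum>b\<in>B. c * ?D (\<lambda>a. g (a, b)) B) + card B * (\<Sum>a\<in>B. c * ?D (\<lambda>b. g (a, b)) B)"
    by (intro add_mono mult_left_mono sum_mono poincare) auto
  also have "\<dots> = card B * c * ((\<Sum>b\<in>B. ?D (\<lambda>a. g (a, b)) B) + (\<Sum>a\<in>B. ?D (\<lambda>b. g (a, b)) B))"
    by (simp add: sum_distrib_left algebra_simps)
  also have "\<dots> \<le> card B * c * dirichlet R' f V"
  proof (intro mult_left_mono)
    let ?w = "\<lambda>a b a' b'. (g (a, b) - g (a', b'))\<^sup>2"
    let ?l = "\<lambda>a b a' b'. if b' = b then (if R a a' then ?w a b a' b else 0) else 0"
    let ?r = "\<lambda>a b a' b'. if a' = a then (if R b b' then ?w a b a b' else 0) else 0"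
    have "(\<Sum>b\<in>B. ?D (\<lambda>a. g (a, b)) B) = (\<Sum>a\<in>B. \<Sum>b\<in>B. \<Sum>a'\<in>B. \<Sum>b'\<in>B. ?l a b a' b')"
      unfolding dirichlet_def by (subst sum.swap) (simp add: fin)
    moreover have "(\<Sum>a\<in>B. ?D (\<lambda>b. g (a, b)) B) = (\<Sum>a\<in>B. \<Sum>b\<in>B. \<Sum>b'\<in>B. \<Sum>a'\<in>B. ?r a b a' b')"
      unfolding dirichlet_def by (simp add: fin)
    moreover have "\<dots> = (\<Sum>a\<in>B. \<Sum>b\<in>B. \<Sum>a'\<in>B. \<Sum>b'\<in>B. ?r a b a' b')"
      by (rule sum.cong[OF refl], rule sum.cong[OF refl], rule sum.swap)
    ultimately have "(\<Sum>b\<in>B. ?D (\<lambda>a. g (a, b)) B) + (\<Sum>a\<in>B. ?D (\<lambda>b. g (a, b)) B) =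
        (\<Sum>a\<in>B. \<Sum>b\<in>B. \<Sum>a'\<in>B. \<Sum>b'\<in>B. ?l a b a' b' + ?r a b a' b')"
      by (simp only: sum.distrib)
    also have "\<dots> \<le> (\<Sum>a\<in>B. \<Sum>b\<in>B. \<Sum>a'\<in>B. \<Sum>b'\<in>B. if R' (J a b) (J a' b') then ?w a b a' b' else 0)"
      by (intro sum_mono) (auto dest: left right)
    also have "\<dots> = dirichlet R' f V"
      unfolding dirichlet_def V_def
      by (simp add: sum.reindex[OF inj] g_def sum.cartesian_product' cong: if_cong)
    finally show "(\<Sum>b\<in>B. ?D (\<lambda>a. g (a, b)) B) + (\<Sum>a\<in>B. ?D (\<lambda>b. g (a, b)) B) \<le> dirichlet R' f V" .
  qed (use c in auto)
  finally show ?thesis by (simp add: V_def)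
qed

section \<open>A Poincare inequality for the flip graph\<close>

text \<open>The left and right halves, respectively the lower and upper halves, of the rectangle
  with lists \<open>u\<close> and \<open>v\<close>. Refining an interval appends a bit, while
  rescaling an interval into one half of \<open>[0, 1]\<close> adds a bit in front.\<close>

definition x_halves :: "bool list \<Rightarrow> bool list \<Rightarrow> tile set" where
  "x_halves u v = {(u @ [False], v), (u @ [True], v)}"

definition y_halves :: "bool list \<Rightarrow> bool list \<Rightarrow> tile set" where
  "y_halves u v = {(u, v @ [False]), (u, v @ [True])}"

text \<open>The two directions of an edge flip; \<open>flip_xy\<close> replaces a vertical edge by a
  horizontal one.\<close>

definition flip_xy :: "tile set \<Rightarrow> tile set \<Rightarrow> bool" where
  "flip_xy \<sigma> \<tau> \<longleftrightarrow> (\<exists>u v. x_halves u v \<subseteq> \<sigma> \<and> \<tau> = \<sigma> - x_halves u v \<union> y_halves u v)"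

definition flip_yx :: "tile set \<Rightarrow> tile set \<Rightarrow> bool" where
  "flip_yx \<sigma> \<tau> \<longleftrightarrow> (\<exists>u v. y_halves u v \<subseteq> \<sigma> \<and> \<tau> = \<sigma> - y_halves u v \<union> x_halves u v)"

definition flip :: "tile set \<Rightarrow> tile set \<Rightarrow> bool" where
  "flip \<sigma> \<tau> \<longleftrightarrow> flip_xy \<sigma> \<tau> \<or> flip_yx \<sigma> \<tau>"

lemma flip_image:
  assumes inj: "inj g" and disj: "\<rho> \<inter> range g = {}"
    and halves: "\<And>u v. \<exists>u' v'. g ` x_halves u v = x_halves u' v' \<and> g ` y_halves u v = y_halves u' v'"
    and "flip \<sigma> \<tau>"
  shows "flip (g ` \<sigma> \<union> \<rho>) (g ` \<tau> \<union> \<rho>)"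
proof -
  have key: "g ` C \<subseteq> g ` \<sigma> \<union> \<rho> \<and> g ` (\<sigma> - C \<union> D) \<union> \<rho> = g ` \<sigma> \<union> \<rho> - g ` C \<union> g ` D"
    if "C \<subseteq> \<sigma>" for C D
    using that disj by (auto simp: image_Un image_set_diff[OF inj])
  from assms(4) show ?thesis unfolding flip_def
  proof
    assume "flip_xy \<sigma> \<tau>"
    then obtain u v where uv: "x_halves u v \<subseteq> \<sigma>" "\<tau> = \<sigma> - x_halves u v \<union> y_halves u v"
      by (auto simp: flip_xy_def)
    obtain u' v' where "g ` x_halves u v = x_halves u' v'" "g ` y_halves u v = y_halves u' v'"
      using halves by blast
    with key[OF uv(1), of "y_halves u v"] have "flip_xy (g ` \<sigma> \<union> \<rho>) (g ` \<tau> \<union> \<rho>)"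
      unfolding flip_xy_def uv(2) by metis
    thus "flip_xy (g ` \<sigma> \<union> \<rho>) (g ` \<tau> \<union> \<rho>) \<or> flip_yx (g ` \<sigma> \<union> \<rho>) (g ` \<tau> \<union> \<rho>)" ..
  next
    assume "flip_yx \<sigma> \<tau>"
    then obtain u v where uv: "y_halves u v \<subseteq> \<sigma>" "\<tau> = \<sigma> - y_halves u v \<union> x_halves u v"
      by (auto simp: flip_yx_def)
    obtain u' v' where "g ` x_halves u v = x_halves u' v'" "g ` y_halves u v = y_halves u' v'"
      using halves by blast
    with key[OF uv(1), of "x_halves u v"] have "flip_yx (g ` \<sigma> \<union> \<rho>) (g ` \<tau> \<union> \<rho>)"
      unfolding flip_yx_def uv(2) by metis
    thus "flip_xy (g ` \<sigma> \<union> \<rho>) (g ` \<tau> \<union> \<rho>) \<or> flip_yx (g ` \<sigma> \<union> \<rho>) (g ` \<tau> \<union> \<rho>)" ..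
  qed
qed

lemma flip_image_Cons:
  assumes "flip \<sigma> \<tau>"
  shows "\<rho> \<inter> range (apfst (Cons b)) = {} \<Longrightarrow> flip (apfst (Cons b) ` \<sigma> \<union> \<rho>) (apfst (Cons b) ` \<tau> \<union> \<rho>)"
    and "\<rho> \<inter> range (apsnd (Cons b)) = {} \<Longrightarrow> flip (apsnd (Cons b) ` \<sigma> \<union> \<rho>) (apsnd (Cons b) ` \<tau> \<union> \<rho>)"
proof -
  have inj: "inj (apfst (Cons b) :: tile \<Rightarrow> tile)" "inj (apsnd (Cons b) :: tile \<Rightarrow> tile)"
    by (auto simp: inj_def)
  have x: "apfst (Cons b) ` x_halves u v = x_halves (b # u) v \<and> apfst (Cons b) ` y_halves u v = y_halves (b # u) v"
    for u v by (simp add: x_halves_def y_halves_def)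
  have y: "apsnd (Cons b) ` x_halves u v = x_halves u (b # v) \<and> apsnd (Cons b) ` y_halves u v = y_halves u (b # v)"
    for u v by (simp add: x_halves_def y_halves_def)
  show "\<rho> \<inter> range (apfst (Cons b)) = {} \<Longrightarrow> flip (apfst (Cons b) ` \<sigma> \<union> \<rho>) (apfst (Cons b) ` \<tau> \<union> \<rho>)"
    by (rule flip_image[OF inj(1) _ _ assms]) (assumption, intro exI, rule x)
  show "\<rho> \<inter> range (apsnd (Cons b)) = {} \<Longrightarrow> flip (apsnd (Cons b) ` \<sigma> \<union> \<rho>) (apsnd (Cons b) ` \<tau> \<union> \<rho>)"
    by (rule flip_image[OF inj(2) _ _ assms]) (assumption, intro exI, rule y)
qed

lemma flip_join:
  assumes "flip \<sigma> \<tau>"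
  shows "flip (join_x \<sigma> \<rho>) (join_x \<tau> \<rho>)" "flip (join_x \<rho> \<sigma>) (join_x \<rho> \<tau>)"
    and "flip (join_y \<sigma> \<rho>) (join_y \<tau> \<rho>)" "flip (join_y \<rho> \<sigma>) (join_y \<rho> \<tau>)"
proof -
  have disj: "apfst (Cons (\<not> b)) ` \<rho> \<inter> range (apfst (Cons b)) = {}"
    "apsnd (Cons (\<not> b)) ` \<rho> \<inter> range (apsnd (Cons b)) = {}" for b and \<rho> :: "tile set"
    by auto
  show "flip (join_x \<sigma> \<rho>) (join_x \<tau> \<rho>)" "flip (join_x \<rho> \<sigma>) (join_x \<rho> \<tau>)"
    "flip (join_y \<sigma> \<rho>) (join_y \<tau> \<rho>)" "flip (join_y \<rho> \<sigma>) (join_y \<rho> \<tau>)"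
    unfolding join_x_def join_y_def
    using flip_image_Cons(1)[OF assms, OF disj(1)[where b = False], of \<rho>]
      flip_image_Cons(1)[OF assms, OF disj(1)[where b = True], of \<rho>]
      flip_image_Cons(2)[OF assms, OF disj(2)[where b = False], of \<rho>]
      flip_image_Cons(2)[OF assms, OF disj(2)[where b = True], of \<rho>]
    by (simp_all add: Un_commute)
qed

text \<open>One level multiplies the constant by \<open>2 \<bar>B\<bar>\<^sup>2 / \<bar>V \<inter>
  H\<bar> \<le> 8\<close>, relative to the number of tilings. At level 1 there are only two tilings,
  which differ by a flip; level 0 cannot start the induction, since the two bisected sets at level 1
  are disjoint.\<close>

lemma poincare_tilings:
  "sqd f (tilings (Suc k)) (tilings (Suc k)) \<le>
     real (card (tilings (Suc k))) * 8 ^ k * dirichlet flip f (tilings (Suc k))"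
proof (induction k arbitrary: f)
  case 0
  have two: "tilings (Suc 0) = {x_halves [] [], y_halves [] []}"
    unfolding tilings_Suc tilings_0 by (simp add: join_x_def join_y_def x_halves_def y_halves_def insert_commute)
  have "flip (x_halves [] []) (y_halves [] [])" "flip (y_halves [] []) (x_halves [] [])"
    unfolding flip_def flip_xy_def flip_yx_def by blast+
  hence "(f \<sigma> - f \<tau>)\<^sup>2 \<le> (if flip \<sigma> \<tau> then (f \<sigma> - f \<tau>)\<^sup>2 else 0)"
    if "\<sigma> \<in> tilings (Suc 0)" "\<tau> \<in> tilings (Suc 0)" for \<sigma> \<tau>
    using that unfolding two by auto
  hence "sqd f (tilings (Suc 0)) (tilings (Suc 0)) \<le> 1 * dirichlet flip f (tilings (Suc 0))"
    unfolding sqd_def dirichlet_def by (simp only: mult_1 sum_mono)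
  also have "\<dots> \<le> card (tilings (Suc 0)) * dirichlet flip f (tilings (Suc 0))"
    using card_tilings_Suc_ge[of 0] by (intro mult_right_mono dirichlet_nonneg) auto
  finally show ?case by simp
next
  case (Suc k)
  let ?B = "tilings (Suc k)" and ?\<Omega> = "tilings (Suc (Suc k))"
  let ?V = "case_prod join_x ` (?B \<times> ?B)" and ?H = "case_prod join_y ` (?B \<times> ?B)"
  let ?c = "real (card ?B) * 8 ^ k" and ?D = "dirichlet flip f ?\<Omega>"
  have cover: "?\<Omega> = ?V \<union> ?H" by (rule tilings_Suc)
  have fin: "finite ?V" "finite ?H" by simp_all
  have "sqd f ?V ?V \<le> real (card ?B) * ?c * dirichlet flip f ?V"
    by (rule poincare_product[where R = flip])
      (auto intro: flip_join Suc.IH simp: inj_on_def join_x_inject)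
  also have "\<dots> \<le> real (card ?B) * ?c * ?D"
    by (intro mult_left_mono dirichlet_mono) (simp_all add: cover)
  finally have V: "sqd f ?V ?V \<le> real (card ?B) * ?c * ?D" .
  have "sqd f ?H ?H \<le> real (card ?B) * ?c * dirichlet flip f ?H"
    by (rule poincare_product[where R = flip])
      (auto intro: flip_join Suc.IH simp: inj_on_def join_y_inject)
  also have "\<dots> \<le> real (card ?B) * ?c * ?D"
    by (intro mult_left_mono dirichlet_mono) (simp_all add: cover)
  finally have H: "sqd f ?H ?H \<le> real (card ?B) * ?c * ?D" .
  let ?Q = "card (?V \<inter> ?H)"
  \<comment> \<open>The set of the tilings bisected in both directions has at least a quarter of the size of each of the two sets.\<close>
  have "(card ?B)\<^sup>2 \<le> (2 * (card (tilings k))\<^sup>2)\<^sup>2"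
    by (intro power_mono card_tilings_Suc_le) simp
  also have "\<dots> = 4 * card (tilings k) ^ 4" by (simp add: power_mult_distrib power_mult[symmetric])
  also have "\<dots> \<le> 4 * ?Q" using card_tilings_both_bisected[of k] by (intro mult_left_mono) auto
  finally have B_le: "(card ?B)\<^sup>2 \<le> 4 * ?Q" .
  have "0 < (card ?B)\<^sup>2" using card_tilings_pos by simp
  hence Q_pos: "?Q > 0" using B_le by linarith
  have "?Q * sqd f ?\<Omega> ?\<Omega> \<le> card ?\<Omega> * (sqd f ?V ?V + sqd f ?H ?H)"
    unfolding cover by (rule sqd_two_cover_le[OF fin]) (simp add: card_joined)
  also have "\<dots> \<le> card ?\<Omega> * (card ?B * ?c * ?D + card ?B * ?c * ?D)"
    by (intro mult_left_mono add_mono V H) simp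
  also have "\<dots> = 2 * real (card ?\<Omega>) * 8 ^ k * ?D * real ((card ?B)\<^sup>2)"
    by (simp add: power2_eq_square)
  also have "\<dots> \<le> 2 * real (card ?\<Omega>) * 8 ^ k * ?D * real (4 * ?Q)"
    using B_le by (intro mult_left_mono mult_nonneg_nonneg dirichlet_nonneg of_nat_mono) auto
  finally have "?Q * sqd f ?\<Omega> ?\<Omega> \<le> ?Q * (real (card ?\<Omega>) * 8 ^ Suc k * ?D)"
    by (simp add: mult_ac)
  thus ?case using Q_pos by (simp only: mult_le_cancel_left_pos of_nat_0_less_iff)
qed

section \<open>Flips and the geometry of the encoding\<close>

lemma not_parallel_snoc:
  fixes u w :: "bool list"
  assumes "\<not> w \<parallel> u"
  obtains b where "\<not> w \<parallel> u @ [b]"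
proof -
  from assms consider "prefix w u" | b z where "w = u @ b # z"
    unfolding parallel_def prefix_def by (metis append.right_neutral list.exhaust)
  thus ?thesis
  proof cases
    case 1
    hence "prefix w (u @ [True])" by simp
    thus ?thesis by (intro that[of True]) (simp only: parallel_def simp_thms)
  next
    case 2
    hence "prefix (u @ [b]) w" by simp
    thus ?thesis by (intro that[of b]) (simp only: parallel_def simp_thms)
  qed
qed

lemma parallel_snoc: "w \<parallel> u \<Longrightarrow> w \<parallel> u @ [b]"
  using parallel_append[of w u "[]" "[b]"] by simp

lemma parallel_snoc_snoc: "u @ [b] \<parallel> u @ [c] \<longleftrightarrow> b \<noteq> c"
  by (auto simp: parallel_def)

lemma not_parallel_snoc_self [simp]: "\<not> u \<parallel> u @ [b]" "\<not> u @ [b] \<parallel> u"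
  by (simp_all add: parallel_def)

lemma tilings_nonoverlap:
  "\<sigma> \<in> tilings k \<Longrightarrow> p \<in> \<sigma> \<Longrightarrow> q \<in> \<sigma> \<Longrightarrow> \<not> nonoverlap p q \<Longrightarrow> p = q"
  by (auto simp: tilings_def packing_def)

lemma y_halves_disjoint:
  assumes "\<sigma> \<in> tilings k" "x_halves u v \<subseteq> \<sigma>"
  shows "y_halves u v \<inter> \<sigma> = {}"
proof -
  have "(u, v @ [b]) \<notin> \<sigma>" for b
  proof
    assume "(u, v @ [b]) \<in> \<sigma>"
    with tilings_nonoverlap[OF assms(1), of "(u, v @ [b])" "(u @ [False], v)"] assms(2)
    show False by (simp add: x_halves_def nonoverlap_def)
  qed
  thus ?thesis by (auto simp: y_halves_def)
qed

lemma flip_xy_tilings: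
  assumes \<sigma>: "\<sigma> \<in> tilings k" and "flip_xy \<sigma> \<tau>"
  shows "\<tau> \<in> tilings k" "flip_yx \<tau> \<sigma>"
proof -
  obtain u v where X: "x_halves u v \<subseteq> \<sigma>" and \<tau>: "\<tau> = \<sigma> - x_halves u v \<union> y_halves u v"
    using assms(2) by (auto simp: flip_xy_def)
  have disj: "y_halves u v \<inter> \<sigma> = {}" by (rule y_halves_disjoint[OF \<sigma> X])
  have fin: "finite \<sigma>" using \<sigma> by (simp add: tilings_def packing_def)
  have cardX: "card (x_halves u v) = 2" "finite (x_halves u v)" by (simp_all add: x_halves_def)
  have cardY: "card (y_halves u v) = 2" "finite (y_halves u v)" by (simp_all add: y_halves_def)
  have len: "length (fst p) + length (snd p) = k" if "p \<in> \<sigma>" for p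
    using \<sigma> that by (simp add: tilings_def packing_def)
  have "card \<tau> = card (\<sigma> - x_halves u v) + card (y_halves u v)"
    unfolding \<tau> using disj fin cardY by (intro card_Un_disjoint) auto
  also have "card (\<sigma> - x_halves u v) = card \<sigma> - 2" using X cardX by (simp add: card_Diff_subset)
  also have "card \<sigma> \<ge> 2" using card_mono[OF fin X] cardX by simp
  hence "card \<sigma> - 2 + card (y_halves u v) = 2 ^ k" using cardY \<sigma> by (simp add: tilings_def)
  finally have card: "card \<tau> = 2 ^ k" .
  have new: "nonoverlap q r" if q: "q \<in> \<sigma> - x_halves u v" and r: "r \<in> y_halves u v" for q r
  proof -
    obtain b where b: "r = (u, v @ [b])" using r by (auto simp: y_halves_def)
    have no: "nonoverlap q (u @ [c], v)" for c
    proof -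
      have "(u @ [c], v) \<in> x_halves u v" by (cases c) (simp_all add: x_halves_def)
      thus ?thesis using tilings_nonoverlap[OF \<sigma>, of q "(u @ [c], v)"] q X by blast
    qed
    show ?thesis
    proof (cases "snd q \<parallel> v")
      case True
      thus ?thesis by (simp add: b nonoverlap_def parallel_snoc)
    next
      case False
      hence "fst q \<parallel> u @ [c]" for c using no[of c] by (simp add: nonoverlap_def)
      hence "fst q \<parallel> u" using not_parallel_snoc[of "fst q" u] by blast
      thus ?thesis by (simp add: b nonoverlap_def)
    qed
  qed
  have yy: "nonoverlap p q" if "p \<in> y_halves u v" "q \<in> y_halves u v" "p \<noteq> q" for p q
    using that by (auto simp: y_halves_def nonoverlap_def parallel_snoc_snoc)
  have "nonoverlap p q" if "p \<in> \<tau>" "q \<in> \<tau>" "p \<noteq> q" for p q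
  proof -
    from that consider "p \<in> \<sigma>" "q \<in> \<sigma>" | "p \<in> \<sigma> - x_halves u v" "q \<in> y_halves u v"
      | "q \<in> \<sigma> - x_halves u v" "p \<in> y_halves u v" | "p \<in> y_halves u v" "q \<in> y_halves u v"
      unfolding \<tau> by blast
    thus ?thesis
    proof cases
      case 1 thus ?thesis using tilings_nonoverlap[OF \<sigma>] that(3) by blast
    next
      case 2 thus ?thesis by (rule new)
    next
      case 3 thus ?thesis using new nonoverlap_sym by blast
    next
      case 4 thus ?thesis using yy that(3) by blast
    qed
  qed
  moreover have "length (fst p) + length (snd p) = k" if "p \<in> \<tau>" for p
  proof (cases "p \<in> \<sigma>")
    case False
    hence "p \<in> y_halves u v" using that \<tau> by blast
    hence "length (fst p) + length (snd p) = length u + length v + 1" by (auto simp: y_halves_def)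
    also have "\<dots> = k" using len[of "(u @ [False], v)"] X by (simp add: x_halves_def)
    finally show ?thesis .
  qed (rule len)
  ultimately show "\<tau> \<in> tilings k" using card fin cardY(2)
    unfolding tilings_def packing_def \<tau> by blast
  show "flip_yx \<tau> \<sigma>" unfolding flip_yx_def
  proof (intro exI conjI)
    show "y_halves u v \<subseteq> \<tau>" by (simp add: \<tau>)
    show "\<sigma> = \<tau> - y_halves u v \<union> x_halves u v" using X disj unfolding \<tau> by blast
  qed
qed

lemma transp_halves: "transp (x_halves u v) = y_halves v u" "transp (y_halves u v) = x_halves v u"
  by (simp_all add: x_halves_def y_halves_def)

lemma flip_transp: "flip_yx \<sigma> \<tau> \<longleftrightarrow> flip_xy (transp \<sigma>) (transp \<tau>)"
proof -
  have sub: "transp A \<subseteq> transp B \<longleftrightarrow> A \<subseteq> B" for A B by (rule inj_image_subset_iff) simp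
  have eq: "transp A = transp B \<longleftrightarrow> A = B" for A B by (rule inj_image_eq_iff) simp
  have "x_halves v u \<subseteq> transp \<sigma> \<longleftrightarrow> y_halves u v \<subseteq> \<sigma>" for u v
    using sub[of "y_halves u v" \<sigma>] by (simp only: transp_halves)
  moreover have "transp \<tau> = transp \<sigma> - x_halves v u \<union> y_halves v u \<longleftrightarrow>
      \<tau> = \<sigma> - y_halves u v \<union> x_halves u v" for u v
    using eq[of \<tau> "\<sigma> - y_halves u v \<union> x_halves u v"]
    by (simp only: image_Un image_set_diff[OF inj_swap] transp_halves)
  ultimately show ?thesis unfolding flip_xy_def flip_yx_def by metis
qed

lemma flip_yx_tilings:
  assumes "\<sigma> \<in> tilings k" "flip_yx \<sigma> \<tau>"
  shows "\<tau> \<in> tilings k" "flip_xy \<tau> \<sigma>"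
proof -
  from assms have *: "transp \<sigma> \<in> tilings k" "flip_xy (transp \<sigma>) (transp \<tau>)"
    by (simp_all add: transp_tilings flip_transp)
  from transp_tilings[OF flip_xy_tilings(1)[OF *]] show "\<tau> \<in> tilings k" by simp
  from flip_xy_tilings(2)[OF *] show "flip_xy \<tau> \<sigma>" by (simp add: flip_transp)
qed

lemma flip_tilings: "\<sigma> \<in> tilings k \<Longrightarrow> flip \<sigma> \<tau> \<Longrightarrow> \<tau> \<in> tilings k"
  unfolding flip_def using flip_xy_tilings flip_yx_tilings by blast

lemma flip_sym: "\<sigma> \<in> tilings k \<Longrightarrow> flip \<sigma> \<tau> \<Longrightarrow> flip \<tau> \<sigma>"
  unfolding flip_def using flip_xy_tilings flip_yx_tilings by blast

text \<open>The endpoints of the interval encoded by a bit list, the interval itself, and the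
  rectangle of a tile.\<close>

fun lo :: "bool list \<Rightarrow> real" where
  "lo [] = 0"
| "lo (b # u) = (of_bool b + lo u) / 2"

definition hi :: "bool list \<Rightarrow> real" where
  "hi u = lo u + 1 / 2 ^ length u"

definition dyad :: "bool list \<Rightarrow> real set" where
  "dyad u = {lo u..hi u}"

definition rect :: "tile \<Rightarrow> (real \<times> real) set" where
  "rect p = dyad (fst p) \<times> dyad (snd p)"

lemma hi_Nil [simp]: "hi [] = 1" by (simp add: hi_def)

lemma hi_Cons [simp]: "hi (b # u) = (of_bool b + hi u) / 2"
  by (simp add: hi_def field_simps)

lemma lo_less_hi: "lo u < hi u" by (simp add: hi_def)

lemma lo_append: "lo (u @ w) = lo u + lo w / 2 ^ length u"
  by (induction u) (simp_all add: field_simps)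

lemma hi_append: "hi (u @ w) = lo u + hi w / 2 ^ length u"
  by (induction u) (simp_all add: field_simps)

lemma lo_nonneg: "0 \<le> lo u" by (induction u) auto

lemma hi_le_1: "hi u \<le> 1" by (induction u) auto

lemma prefix_bounds: "prefix u v \<Longrightarrow> lo u \<le> lo v \<and> hi v \<le> hi u"
proof (elim prefixE, simp only: lo_append hi_append)
  fix w show "lo u \<le> lo u + lo w / 2 ^ length u \<and> lo u + hi w / 2 ^ length u \<le> hi u"
    using lo_nonneg[of w] hi_le_1[of w] unfolding hi_def[of u] by (simp add: divide_right_mono)
qed

lemma parallel_bounds: "u \<parallel> v \<Longrightarrow> hi u \<le> lo v \<or> hi v \<le> lo u"
proof (induction u v rule: list_induct2')
  case (4 a u b v)
  show ?case
  proof (cases "a = b")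
    case True
    thus ?thesis using 4 by (auto simp: parallel_Cons)
  next
    case False
    thus ?thesis using lo_nonneg[of u] lo_nonneg[of v] hi_le_1[of u] hi_le_1[of v] by (cases a; cases b) auto
  qed
qed auto

text \<open>Dyadic intervals are nested or have disjoint interiors.\<close>

lemma parallel_iff_interior: "u \<parallel> v \<longleftrightarrow> {lo u<..<hi u} \<inter> {lo v<..<hi v} = {}"
proof
  assume "u \<parallel> v"
  thus "{lo u<..<hi u} \<inter> {lo v<..<hi v} = {}" using parallel_bounds by fastforce
next
  assume disj: "{lo u<..<hi u} \<inter> {lo v<..<hi v} = {}"
  show "u \<parallel> v"
  proof (rule ccontr)
    assume "\<not> u \<parallel> v"
    hence "prefix u v \<or> prefix v u" by (simp add: parallel_def)
    hence "{lo v<..<hi v} \<subseteq> {lo u<..<hi u} \<or> {lo u<..<hi u} \<subseteq> {lo v<..<hi v}"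
      using prefix_bounds[of u v] prefix_bounds[of v u] by fastforce
    hence "{lo u<..<hi u} = {} \<or> {lo v<..<hi v} = {}" using disj by blast
    thus False using lo_less_hi[of u] lo_less_hi[of v] by simp
  qed
qed

lemma lo_eq_imp_not_parallel: "lo u = lo v \<Longrightarrow> \<not> u \<parallel> v"
  using parallel_bounds[of u v] lo_less_hi[of u] lo_less_hi[of v] by auto

lemma hi_eq_imp_not_parallel: "hi u = hi v \<Longrightarrow> \<not> u \<parallel> v"
  using parallel_bounds[of u v] lo_less_hi[of u] lo_less_hi[of v] by auto

lemma dyad_nonempty [simp]: "dyad u \<noteq> {}"
  using lo_less_hi[of u] by (simp add: dyad_def)

lemma dyad_eq_iff [simp]: "dyad u = dyad v \<longleftrightarrow> u = v"
proof
  assume "dyad u = dyad v"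
  hence eq: "lo u = lo v" "hi u = hi v" using lo_less_hi[of u] by (auto simp: dyad_def Icc_eq_Icc)
  hence "length u = length v" by (simp add: hi_def)
  moreover have "prefix u v \<or> prefix v u" using lo_eq_imp_not_parallel[OF eq(1)] by (simp add: parallel_def)
  ultimately show "u = v" by (auto simp: prefix_def)
qed simp

lemma dyad_neq_singleton: "dyad u \<noteq> {x}"
  using lo_less_hi[of u] by (auto simp: dyad_def)

lemma rect_eq_iff: "rect p = rect q \<longleftrightarrow> p = q"
  by (cases p; cases q) (simp add: rect_def times_eq_iff)

lemma inj_rect: "inj rect" by (simp add: inj_def rect_eq_iff)

lemma lo_as_fraction: "\<exists>a<2 ^ length u. lo u = real a / 2 ^ length u"
proof (induction u)
  case (Cons b u)
  then obtain a where "a < 2 ^ length u" "lo u = real a / 2 ^ length u" by blast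
  thus ?case by (intro exI[of _ "of_bool b * 2 ^ length u + a"]) (auto simp: field_simps)
qed simp

lemma fraction_as_lo: "a < 2 ^ s \<Longrightarrow> \<exists>u. length u = s \<and> lo u = real a / 2 ^ s"
proof (induction s arbitrary: a)
  case (Suc s)
  show ?case
  proof (cases "a < 2 ^ s")
    case True
    then obtain u where "length u = s" "lo u = real a / 2 ^ s" using Suc.IH by blast
    thus ?thesis by (intro exI[of _ "False # u"]) simp
  next
    case False
    then obtain c where c: "a = 2 ^ s + c" using le_Suc_ex by (metis not_less)
    then obtain u where "length u = s" "lo u = real c / 2 ^ s" using Suc.IH[of c] Suc.prems by auto
    thus ?thesis by (intro exI[of _ "True # u"]) (simp add: c field_simps)
  qed
qed simp

lemma dyadic_interval_iff: "dyadic_interval I \<longleftrightarrow> (\<exists>u. I = dyad u)"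
proof
  assume "dyadic_interval I"
  then obtain a s where a: "a < 2 ^ s" and I: "I = {real a / 2 ^ s..(real a + 1) / 2 ^ s}"
    by (auto simp: dyadic_interval_def)
  obtain u where "length u = s" "lo u = real a / 2 ^ s" using fraction_as_lo[OF a] by blast
  hence "I = dyad u" by (simp add: I dyad_def hi_def add_divide_distrib)
  thus "\<exists>u. I = dyad u" ..
next
  assume "\<exists>u. I = dyad u"
  then obtain u where I: "I = dyad u" ..
  obtain a where "a < 2 ^ length u" "lo u = real a / 2 ^ length u" using lo_as_fraction by blast
  thus "dyadic_interval I" unfolding dyadic_interval_def
    by (intro exI[of _ a] exI[of _ "length u"]) (simp add: I dyad_def hi_def add_divide_distrib)
qed

lemma dyadic_rectangle_iff: "dyadic_rectangle R \<longleftrightarrow> (\<exists>p. R = rect p)"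
  by (auto simp: dyadic_rectangle_def dyadic_interval_iff rect_def)

lemma rect_eq_cbox: "rect (u, v) = cbox (lo u, lo v) (hi u, hi v)"
  by (simp add: rect_def dyad_def cbox_Pair_eq)

lemma measure_rect: "measure lborel (rect p) = 1 / 2 ^ (length (fst p) + length (snd p))"
proof (cases p)
  case (Pair u v)
  have "measure lborel (rect p) = measure lborel (cbox (lo u) (hi u)) * measure lborel (cbox (lo v) (hi v))"
    unfolding Pair rect_eq_cbox by (rule content_Pair)
  thus ?thesis using lo_less_hi[of u] lo_less_hi[of v] by (simp add: Pair hi_def power_add)
qed

lemma interior_rect_disjoint_iff: "interior (rect p) \<inter> interior (rect q) = {} \<longleftrightarrow> nonoverlap p q"
  by (auto simp: rect_def dyad_def interior_Times Times_Int_Times nonoverlap_def parallel_iff_interior)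

lemma rect_Cons:
  "(x, y) \<in> rect (apfst (Cons b) p) \<longleftrightarrow> (2 * x - of_bool b, y) \<in> rect p"
  "(x, y) \<in> rect (apsnd (Cons b) p) \<longleftrightarrow> (x, 2 * y - of_bool b) \<in> rect p"
  by (auto simp: rect_def dyad_def field_simps)

text \<open>By induction along the bisections a packing of maximal size covers the unit
  square.\<close>

lemma tilings_cover:
  "\<sigma> \<in> tilings k \<Longrightarrow> (x, y) \<in> {0..1} \<times> {0..1} \<Longrightarrow> \<exists>p\<in>\<sigma>. (x, y) \<in> rect p"
proof (induction k arbitrary: \<sigma> x y)
  case 0
  thus ?case by (auto simp: tilings_0 rect_def dyad_def)
next
  case (Suc k)
  from Suc.prems(1) obtain \<sigma>1 \<sigma>2 where t: "\<sigma>1 \<in> tilings k" "\<sigma>2 \<in> tilings k"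
    and \<sigma>: "\<sigma> = join_x \<sigma>1 \<sigma>2 \<or> \<sigma> = join_y \<sigma>1 \<sigma>2"
    unfolding tilings_Suc by auto
  define h where "h b = (if b then \<sigma>2 else \<sigma>1)" for b
  have h: "h b \<in> tilings k" for b using t by (simp add: h_def)
  from \<sigma> show ?case
  proof
    assume eq: "\<sigma> = join_x \<sigma>1 \<sigma>2"
    define b where "b \<longleftrightarrow> x > 1 / 2"
    have "(2 * x - of_bool b, y) \<in> {0..1} \<times> {0..1}" using Suc.prems(2) by (cases b) (auto simp: b_def)
    then obtain p where "p \<in> h b" "(2 * x - of_bool b, y) \<in> rect p"
      using Suc.IH[OF h] by blast
    moreover from this(1) have "apfst (Cons b) p \<in> \<sigma>" by (cases b) (auto simp: eq join_x_def h_def)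
    ultimately show ?thesis by (metis rect_Cons(1))
  next
    assume eq: "\<sigma> = join_y \<sigma>1 \<sigma>2"
    define b where "b \<longleftrightarrow> y > 1 / 2"
    have "(x, 2 * y - of_bool b) \<in> {0..1} \<times> {0..1}" using Suc.prems(2) by (cases b) (auto simp: b_def)
    then obtain p where "p \<in> h b" "(x, 2 * y - of_bool b) \<in> rect p"
      using Suc.IH[OF h] by blast
    moreover from this(1) have "apsnd (Cons b) p \<in> \<sigma>" by (cases b) (auto simp: eq join_y_def h_def)
    ultimately show ?thesis by (metis rect_Cons(2))
  qed
qed

lemma rect_subset_unit_square: "rect p \<subseteq> {0..1} \<times> {0..1}"
proof -
  have "dyad u \<subseteq> {0..1}" for u using lo_nonneg[of u] hi_le_1[of u] by (auto simp: dyad_def)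
  thus ?thesis unfolding rect_def by (intro Sigma_mono) auto
qed

lemma rect_image_in_dyadic_tilings:
  assumes "\<sigma> \<in> tilings k"
  shows "rect ` \<sigma> \<in> dyadic_tilings k"
proof -
  have pk: "packing k \<sigma>" and card: "card \<sigma> = 2 ^ k" using assms by (auto simp: tilings_def)
  have inj: "inj_on rect \<sigma>" using inj_rect by (rule inj_on_subset) simp
  have "rect ` \<sigma> division_of ({0..1} \<times> {0..1})"
    unfolding division_of_def
  proof (intro conjI ballI impI)
    show "finite (rect ` \<sigma>)" using pk by (simp add: packing_def)
    fix R assume "R \<in> rect ` \<sigma>"
    then obtain u v where R: "R = rect (u, v)" "(u, v) \<in> \<sigma>" by auto
    show "R \<subseteq> {0..1} \<times> {0..1}" "R \<noteq> {}" "\<exists>a b. R = cbox a b"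
      using rect_subset_unit_square[of "(u, v)"] rect_eq_cbox[of u v] unfolding R(1)
      by (auto simp: rect_def)
    fix R' assume "R' \<in> rect ` \<sigma>" "R \<noteq> R'"
    then obtain q where q: "R' = rect q" "q \<in> \<sigma>" "(u, v) \<noteq> q" using R(1) by auto
    hence "nonoverlap (u, v) q" using pk R(2) unfolding packing_def by blast
    thus "interior R \<inter> interior R' = {}" unfolding R(1) q(1) interior_rect_disjoint_iff .
  next
    show "\<Union> (rect ` \<sigma>) = {0..1} \<times> {0..1}"
    proof
      show "\<Union> (rect ` \<sigma>) \<subseteq> {0..1} \<times> {0..1}" using rect_subset_unit_square by blast
      show "{0..1} \<times> {0..1} \<subseteq> \<Union> (rect ` \<sigma>)"
      proof
        fix z :: "real \<times> real" assume "z \<in> {0..1} \<times> {0..1}"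
        thus "z \<in> \<Union> (rect ` \<sigma>)" using tilings_cover[OF assms, of "fst z" "snd z"] by simp
      qed
    qed
  qed
  moreover have "card (rect ` \<sigma>) = 2 ^ k" using card_image[OF inj] card by simp
  moreover have "dyadic_rectangle R \<and> measure lborel R = 1 / 2 ^ k" if "R \<in> rect ` \<sigma>" for R
    using that pk by (auto simp: packing_def dyadic_rectangle_iff measure_rect)
  ultimately show ?thesis by (simp add: dyadic_tilings_def)
qed

text \<open>The encoding is faithful: tilings of the square by sets of reals correspond to tilings
  by bit lists.\<close>

lemma dyadic_tilings_eq: "dyadic_tilings k = (`) rect ` tilings k"
proof (intro subset_antisym subsetI)
  fix D assume "D \<in> dyadic_tilings k"
  hence div: "D division_of ({0..1} \<times> {0..1})" and card: "card D = 2 ^ k"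
    and dy: "\<And>R. R \<in> D \<Longrightarrow> dyadic_rectangle R" "\<And>R. R \<in> D \<Longrightarrow> measure lborel R = 1 / 2 ^ k"
    by (auto simp: dyadic_tilings_def)
  define \<sigma> where "\<sigma> = rect -` D"
  have D: "D = rect ` \<sigma>" using dy(1) unfolding \<sigma>_def dyadic_rectangle_iff by auto
  have inj: "inj_on rect \<sigma>" using inj_rect by (rule inj_on_subset) simp
  have "finite \<sigma>" unfolding \<sigma>_def using div inj_rect by (intro finite_vimageI) auto
  moreover have "length (fst p) + length (snd p) = k" if "p \<in> \<sigma>" for p
    using dy(2)[of "rect p"] that by (simp add: \<sigma>_def measure_rect)
  moreover have "nonoverlap p q" if "p \<in> \<sigma>" "q \<in> \<sigma>" "p \<noteq> q" for p q
    using division_ofD(5)[OF div, of "rect p" "rect q"] that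
    by (simp add: \<sigma>_def rect_eq_iff interior_rect_disjoint_iff)
  moreover have "card \<sigma> = 2 ^ k" using card card_image[OF inj] D by simp
  ultimately have "\<sigma> \<in> tilings k" by (simp add: tilings_def packing_def)
  thus "D \<in> (`) rect ` tilings k" using D by blast
next
  fix D assume "D \<in> (`) rect ` tilings k"
  thus "D \<in> dyadic_tilings k" using rect_image_in_dyadic_tilings by blast
qed

section \<open>Transition probabilities of the edge-flip chain\<close>

lemma midpoint_snoc:
  "lo (u @ [False]) = lo u" "lo (u @ [True]) = (lo u + hi u) / 2"
  "hi (u @ [False]) = (lo u + hi u) / 2" "hi (u @ [True]) = hi u"
  by (simp_all add: lo_append hi_append hi_def field_simps)

lemma rect_x_halves: "rect ` x_halves u v = vertical_halves (lo u) (hi u) (lo v) (hi v)"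
  by (simp add: x_halves_def vertical_halves_def rect_def dyad_def midpoint_snoc)

lemma rect_y_halves: "rect ` y_halves u v = horizontal_halves (lo u) (hi u) (lo v) (hi v)"
  by (simp add: y_halves_def horizontal_halves_def rect_def dyad_def midpoint_snoc)

lemma rect_image_subset_iff: "rect ` A \<subseteq> rect ` B \<longleftrightarrow> A \<subseteq> B"
  by (rule inj_image_subset_iff[OF inj_rect])

lemma rect_image_eq_iff: "rect ` A = rect ` B \<longleftrightarrow> A = B"
  by (rule inj_image_eq_iff[OF inj_rect])

lemma rect_image_exchange: "rect ` (\<sigma> - A \<union> B) = rect ` \<sigma> - rect ` A \<union> rect ` B"
  by (simp add: image_Un image_set_diff[OF inj_rect])

lemma interval_eq_dyad:
  assumes "{a..b} = dyad u" "a < b"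
  shows "a = lo u" "b = hi u"
  using assms by (auto simp: dyad_def Icc_eq_Icc)

lemma rectangle_eq_rect:
  assumes "{a..b} \<times> {c..d} = rect p" "a \<le> b" "c \<le> (d :: real)"
  shows "{a..b} = dyad (fst p)" "{c..d} = dyad (snd p)"
  using assms by (auto simp: rect_def times_eq_iff)

text \<open>The successors of a tiling under the replacement of the edge \<open>e\<close>. The
  bisected rectangle is dyadic because of the dyadicity of the tiles before and after the
  replacement: the new halves show it for one side of the rectangle and the old halves for the
  other.\<close>

lemma dyadic_flip_iff:
  assumes \<sigma>: "\<sigma> \<in> tilings k"
  shows "D \<in> dyadic_tilings k \<and> replaces_bisector (rect ` \<sigma>) e D \<longleftrightarrow>
    (\<exists>u v. x_halves u v \<subseteq> \<sigma> \<and> e = {lo (u @ [True])} \<times> dyad v \<and>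
       D = rect ` (\<sigma> - x_halves u v \<union> y_halves u v)) \<or>
    (\<exists>u v. y_halves u v \<subseteq> \<sigma> \<and> e = dyad u \<times> {lo (v @ [True])} \<and>
       D = rect ` (\<sigma> - y_halves u v \<union> x_halves u v))" (is "_ \<longleftrightarrow> ?X \<or> ?Y")
proof
  assume "D \<in> dyadic_tilings k \<and> replaces_bisector (rect ` \<sigma>) e D"
  hence D: "D \<in> dyadic_tilings k" and "replaces_bisector (rect ` \<sigma>) e D" by auto
  have D_rect: "\<exists>p. R = rect p" if "R \<in> D" for R
    using D that unfolding dyadic_tilings_def dyadic_rectangle_iff by blast
  from \<open>replaces_bisector (rect ` \<sigma>) e D\<close> show "?X \<or> ?Y"
  proof cases
    case (vertical a b c d)
    have "{a..b} \<times> {c..(c + d) / 2} \<in> D" unfolding vertical(2) horizontal_halves_def by blast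
    then obtain p where p: "{a..b} \<times> {c..(c + d) / 2} = rect p" using D_rect by blast
    have "{a..(a + b) / 2} \<times> {c..d} \<in> rect ` \<sigma>" using vertical(5) unfolding vertical_halves_def by blast
    then obtain q where q: "{a..(a + b) / 2} \<times> {c..d} = rect q" by blast
    define u v where "u = fst p" and "v = snd q"
    have "{a..b} = dyad u" "{c..d} = dyad v"
      using rectangle_eq_rect(1)[OF p] rectangle_eq_rect(2)[OF q] vertical(3,4) by (simp_all add: u_def v_def)
    from interval_eq_dyad[OF this(1) vertical(3)] interval_eq_dyad[OF this(2) vertical(4)]
    have eqs: "a = lo u" "b = hi u" "c = lo v" "d = hi v" by simp_all
    have "x_halves u v \<subseteq> \<sigma>"
      using vertical(5) unfolding eqs rect_x_halves[symmetric] rect_image_subset_iff .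
    moreover have "e = {lo (u @ [True])} \<times> dyad v"
      using vertical(1) unfolding eqs midpoint_snoc dyad_def .
    moreover have "D = rect ` (\<sigma> - x_halves u v \<union> y_halves u v)"
      using vertical(2) unfolding eqs rect_image_exchange rect_x_halves rect_y_halves .
    ultimately show ?thesis by blast
  next
    case (horizontal a b c d)
    have "{a..(a + b) / 2} \<times> {c..d} \<in> D" unfolding horizontal(2) vertical_halves_def by blast
    then obtain p where p: "{a..(a + b) / 2} \<times> {c..d} = rect p" using D_rect by blast
    have "{a..b} \<times> {c..(c + d) / 2} \<in> rect ` \<sigma>" using horizontal(5) unfolding horizontal_halves_def by blast
    then obtain q where q: "{a..b} \<times> {c..(c + d) / 2} = rect q" by blast
    define u v where "u = fst q" and "v = snd p"
    have "{a..b} = dyad u" "{c..d} = dyad v"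
      using rectangle_eq_rect(1)[OF q] rectangle_eq_rect(2)[OF p] horizontal(3,4) by (simp_all add: u_def v_def)
    from interval_eq_dyad[OF this(1) horizontal(3)] interval_eq_dyad[OF this(2) horizontal(4)]
    have eqs: "a = lo u" "b = hi u" "c = lo v" "d = hi v" by simp_all
    have "y_halves u v \<subseteq> \<sigma>"
      using horizontal(5) unfolding eqs rect_y_halves[symmetric] rect_image_subset_iff .
    moreover have "e = dyad u \<times> {lo (v @ [True])}"
      using horizontal(1) unfolding eqs midpoint_snoc dyad_def .
    moreover have "D = rect ` (\<sigma> - y_halves u v \<union> x_halves u v)"
      using horizontal(2) unfolding eqs rect_image_exchange rect_x_halves rect_y_halves .
    ultimately show ?thesis by blast
  qed
next
  assume "?X \<or> ?Y"
  thus "D \<in> dyadic_tilings k \<and> replaces_bisector (rect ` \<sigma>) e D"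
  proof
    assume ?X
    then obtain u v where *: "x_halves u v \<subseteq> \<sigma>" "e = {lo (u @ [True])} \<times> dyad v"
      "D = rect ` (\<sigma> - x_halves u v \<union> y_halves u v)" by blast
    have "flip_xy \<sigma> (\<sigma> - x_halves u v \<union> y_halves u v)" unfolding flip_xy_def using *(1) by blast
    hence "D \<in> dyadic_tilings k" unfolding *(3)
      by (intro rect_image_in_dyadic_tilings flip_xy_tilings(1)[OF \<sigma>])
    moreover have "replaces_bisector (rect ` \<sigma>) e D"
      unfolding *(2,3) midpoint_snoc dyad_def rect_image_exchange rect_x_halves rect_y_halves
      using *(1) by (intro replaces_bisector.vertical lo_less_hi)
        (simp only: rect_x_halves[symmetric] rect_image_subset_iff)
    ultimately show ?thesis ..
  next
    assume ?Y
    then obtain u v where *: "y_halves u v \<subseteq> \<sigma>" "e = dyad u \<times> {lo (v @ [True])}"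
      "D = rect ` (\<sigma> - y_halves u v \<union> x_halves u v)" by blast
    have "flip_yx \<sigma> (\<sigma> - y_halves u v \<union> x_halves u v)" unfolding flip_yx_def using *(1) by blast
    hence "D \<in> dyadic_tilings k" unfolding *(3)
      by (intro rect_image_in_dyadic_tilings flip_yx_tilings(1)[OF \<sigma>])
    moreover have "replaces_bisector (rect ` \<sigma>) e D"
      unfolding *(2,3) midpoint_snoc dyad_def rect_image_exchange rect_x_halves rect_y_halves
      using *(1) by (intro replaces_bisector.horizontal lo_less_hi)
        (simp only: rect_y_halves[symmetric] rect_image_subset_iff)
    ultimately show ?thesis ..
  qed
qed

lemma side_of_rect:
  "side_of LeftSide (rect p) = {lo (fst p)} \<times> dyad (snd p)"
  "side_of RightSide (rect p) = {hi (fst p)} \<times> dyad (snd p)"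
  "side_of TopSide (rect p) = dyad (fst p) \<times> {hi (snd p)}"
  "side_of BottomSide (rect p) = dyad (fst p) \<times> {lo (snd p)}"
proof -
  have u: "lo (fst p) \<le> hi (fst p)" and v: "lo (snd p) \<le> hi (snd p)"
    using lo_less_hi less_imp_le by blast+
  have mem: "(lo (fst p), lo (snd p)) \<in> rect p" "(hi (fst p), hi (snd p)) \<in> rect p"
    using u v by (simp_all add: rect_def dyad_def)
  have ext: "(\<forall>q\<in>rect p. a \<le> fst q) \<longleftrightarrow> a \<le> lo (fst p)" "(\<forall>q\<in>rect p. fst q \<le> a) \<longleftrightarrow> hi (fst p) \<le> a"
    "(\<forall>q\<in>rect p. a \<le> snd q) \<longleftrightarrow> a \<le> lo (snd p)" "(\<forall>q\<in>rect p. snd q \<le> a) \<longleftrightarrow> hi (snd p) \<le> a" for a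
  proof -
    have "lo (fst p) \<le> fst q \<and> fst q \<le> hi (fst p) \<and> lo (snd p) \<le> snd q \<and> snd q \<le> hi (snd p)"
      if "q \<in> rect p" for q
      using that by (auto simp: rect_def dyad_def)
    thus "(\<forall>q\<in>rect p. a \<le> fst q) \<longleftrightarrow> a \<le> lo (fst p)" "(\<forall>q\<in>rect p. fst q \<le> a) \<longleftrightarrow> hi (fst p) \<le> a"
      "(\<forall>q\<in>rect p. a \<le> snd q) \<longleftrightarrow> a \<le> lo (snd p)" "(\<forall>q\<in>rect p. snd q \<le> a) \<longleftrightarrow> hi (snd p) \<le> a"
      using mem by (metis fst_conv snd_conv order_trans)+
  qed
  show "side_of LeftSide (rect p) = {lo (fst p)} \<times> dyad (snd p)"
    "side_of RightSide (rect p) = {hi (fst p)} \<times> dyad (snd p)"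
    "side_of TopSide (rect p) = dyad (fst p) \<times> {hi (snd p)}"
    "side_of BottomSide (rect p) = dyad (fst p) \<times> {lo (snd p)}"
    unfolding side_of.simps ext using u v by (auto simp: rect_def dyad_def)
qed

lemma side_of_x_halves:
  assumes \<sigma>: "\<sigma> \<in> tilings k" "p \<in> \<sigma>" "x_halves u v \<subseteq> \<sigma>"
  shows "side_of s (rect p) = {lo (u @ [True])} \<times> dyad v \<longleftrightarrow>
    s = RightSide \<and> p = (u @ [False], v) \<or> s = LeftSide \<and> p = (u @ [True], v)"
proof -
  have mem: "(u @ [False], v) \<in> \<sigma>" "(u @ [True], v) \<in> \<sigma>" using assms(3) by (auto simp: x_halves_def)
  have L: "p = (u @ [True], v)" if "lo (fst p) = lo (u @ [True])" "snd p = v"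
    using lo_eq_imp_not_parallel[OF that(1)] that(2)
    by (intro tilings_nonoverlap[OF assms(1,2) mem(2)]) (simp add: nonoverlap_def)
  have R: "p = (u @ [False], v)" if "hi (fst p) = hi (u @ [False])" "snd p = v"
    using hi_eq_imp_not_parallel[OF that(1)] that(2)
    by (intro tilings_nonoverlap[OF assms(1,2) mem(1)]) (simp add: nonoverlap_def)
  show ?thesis
    using L R dyad_neq_singleton[of "fst p" "lo (u @ [True])"]
    by (cases s) (auto simp: side_of_rect times_eq_iff midpoint_snoc simp del: side_of.simps)
qed

lemma side_of_y_halves:
  assumes \<sigma>: "\<sigma> \<in> tilings k" "p \<in> \<sigma>" "y_halves u v \<subseteq> \<sigma>"
  shows "side_of s (rect p) = dyad u \<times> {lo (v @ [True])} \<longleftrightarrow>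
    s = TopSide \<and> p = (u, v @ [False]) \<or> s = BottomSide \<and> p = (u, v @ [True])"
proof -
  have mem: "(u, v @ [False]) \<in> \<sigma>" "(u, v @ [True]) \<in> \<sigma>" using assms(3) by (auto simp: y_halves_def)
  have L: "p = (u, v @ [True])" if "lo (snd p) = lo (v @ [True])" "fst p = u"
    using lo_eq_imp_not_parallel[OF that(1)] that(2)
    by (intro tilings_nonoverlap[OF assms(1,2) mem(2)]) (simp add: nonoverlap_def)
  have R: "p = (u, v @ [False])" if "hi (snd p) = hi (v @ [False])" "fst p = u"
    using hi_eq_imp_not_parallel[OF that(1)] that(2)
    by (intro tilings_nonoverlap[OF assms(1,2) mem(1)]) (simp add: nonoverlap_def)
  show ?thesis
    using L R dyad_neq_singleton[of "snd p" "lo (v @ [True])"]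
    by (cases s) (auto simp: side_of_rect times_eq_iff midpoint_snoc simp del: side_of.simps)
qed

text \<open>\<open>side_flip \<sigma> s p \<tau>\<close>: the side \<open>s\<close> of the tile
  \<open>p\<close> is an edge whose flip leads from \<open>\<sigma>\<close> to
  \<open>\<tau>\<close>.\<close>

definition side_flip :: "tile set \<Rightarrow> direction \<Rightarrow> tile \<Rightarrow> tile set \<Rightarrow> bool" where
  "side_flip \<sigma> s p \<tau> \<longleftrightarrow>
     (\<exists>u v. x_halves u v \<subseteq> \<sigma> \<and> \<tau> = \<sigma> - x_halves u v \<union> y_halves u v \<and>
       (s = RightSide \<and> p = (u @ [False], v) \<or> s = LeftSide \<and> p = (u @ [True], v))) \<or>
     (\<exists>u v. y_halves u v \<subseteq> \<sigma> \<and> \<tau> = \<sigma> - y_halves u v \<union> x_halves u v \<and>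
       (s = TopSide \<and> p = (u, v @ [False]) \<or> s = BottomSide \<and> p = (u, v @ [True])))"

lemma side_flip_unique: "side_flip \<sigma> s p \<tau> \<Longrightarrow> side_flip \<sigma> s p \<tau>' \<Longrightarrow> \<tau> = \<tau>'"
  unfolding side_flip_def by (elim disjE exE conjE) simp_all

lemma side_flip_imp_flip: "side_flip \<sigma> s p \<tau> \<Longrightarrow> flip \<sigma> \<tau>"
  unfolding side_flip_def flip_def flip_xy_def flip_yx_def by blast

lemma flip_edge_rect:
  assumes \<sigma>: "\<sigma> \<in> tilings k" "p \<in> \<sigma>"
  shows "side_flip \<sigma> s p \<tau> \<Longrightarrow> flip_edge k (rect ` \<sigma>) (side_of s (rect p)) = rect ` \<tau>"
    and "\<nexists>\<tau>. side_flip \<sigma> s p \<tau> \<Longrightarrow> flip_edge k (rect ` \<sigma>) (side_of s (rect p)) = rect ` \<sigma>"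
proof -
  let ?e = "side_of s (rect p)"
  have iff: "D \<in> dyadic_tilings k \<and> replaces_bisector (rect ` \<sigma>) ?e D \<longleftrightarrow>
      (\<exists>\<tau>. D = rect ` \<tau> \<and> side_flip \<sigma> s p \<tau>)" for D
  proof -
    have side_flip_iff: "side_flip \<sigma> s p \<tau> \<longleftrightarrow>
        (\<exists>u v. x_halves u v \<subseteq> \<sigma> \<and> ?e = {lo (u @ [True])} \<times> dyad v \<and> \<tau> = \<sigma> - x_halves u v \<union> y_halves u v) \<or>
        (\<exists>u v. y_halves u v \<subseteq> \<sigma> \<and> ?e = dyad u \<times> {lo (v @ [True])} \<and> \<tau> = \<sigma> - y_halves u v \<union> x_halves u v)" for \<tau>
      unfolding side_flip_def
      by (intro arg_cong2[where f = "(\<or>)"] ex_cong1)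
        (use side_of_x_halves[OF \<sigma>] side_of_y_halves[OF \<sigma>] in blast)+
    show ?thesis unfolding dyadic_flip_iff[OF \<sigma>(1)]
    proof
      assume "\<exists>\<tau>. D = rect ` \<tau> \<and> side_flip \<sigma> s p \<tau>"
      then obtain \<tau> where D: "D = rect ` \<tau>" and "side_flip \<sigma> s p \<tau>" by blast
      from this(2) show "(\<exists>u v. x_halves u v \<subseteq> \<sigma> \<and> ?e = {lo (u @ [True])} \<times> dyad v \<and>
            D = rect ` (\<sigma> - x_halves u v \<union> y_halves u v)) \<or>
          (\<exists>u v. y_halves u v \<subseteq> \<sigma> \<and> ?e = dyad u \<times> {lo (v @ [True])} \<and>
            D = rect ` (\<sigma> - y_halves u v \<union> x_halves u v))"
        unfolding side_flip_iff D rect_image_eq_iff .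
    next
      assume "(\<exists>u v. x_halves u v \<subseteq> \<sigma> \<and> ?e = {lo (u @ [True])} \<times> dyad v \<and>
            D = rect ` (\<sigma> - x_halves u v \<union> y_halves u v)) \<or>
          (\<exists>u v. y_halves u v \<subseteq> \<sigma> \<and> ?e = dyad u \<times> {lo (v @ [True])} \<and>
            D = rect ` (\<sigma> - y_halves u v \<union> x_halves u v))" (is "?X \<or> ?Y")
      then obtain \<tau> where "D = rect ` \<tau>" by metis
      with \<open>?X \<or> ?Y\<close> show "\<exists>\<tau>. D = rect ` \<tau> \<and> side_flip \<sigma> s p \<tau>"
        unfolding \<open>D = rect ` \<tau>\<close> rect_image_eq_iff side_flip_iff[symmetric] by blast
    qed
  qed
  show "flip_edge k (rect ` \<sigma>) ?e = rect ` \<sigma>" if "\<nexists>\<tau>. side_flip \<sigma> s p \<tau>"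
  proof -
    have "\<not> (\<exists>D\<in>dyadic_tilings k. replaces_bisector (rect ` \<sigma>) ?e D)" using iff that by metis
    thus ?thesis by (simp add: flip_edge_def del: side_of.simps)
  qed
  show "flip_edge k (rect ` \<sigma>) ?e = rect ` \<tau>" if "side_flip \<sigma> s p \<tau>"
  proof -
    have "(THE D. D \<in> dyadic_tilings k \<and> replaces_bisector (rect ` \<sigma>) ?e D) = rect ` \<tau>"
      unfolding iff using that side_flip_unique by (intro the_equality) blast+
    moreover have "\<exists>D\<in>dyadic_tilings k. replaces_bisector (rect ` \<sigma>) ?e D"
      using iff that by metis
    ultimately show ?thesis by (simp add: flip_edge_def del: side_of.simps)
  qed
qed

lemma flip_edge_rect_cases:
  assumes "\<sigma> \<in> tilings k" "p \<in> \<sigma>"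
  obtains \<tau> where "flip_edge k (rect ` \<sigma>) (side_of s (rect p)) = rect ` \<tau>" "\<tau> \<in> tilings k"
  using assms flip_edge_rect[OF assms] side_flip_imp_flip flip_tilings by metis

lemma UNIV_direction: "(UNIV :: direction set) = {LeftSide, RightSide, TopSide, BottomSide}"
proof -
  have "s \<in> {LeftSide, RightSide, TopSide, BottomSide}" for s by (cases s) auto
  thus ?thesis by blast
qed

lemma card_UNIV_direction: "card (UNIV :: direction set) = 4" "finite (UNIV :: direction set)"
  by (simp_all add: UNIV_direction)

lemma pmf_edge_flip_chain:
  assumes "\<sigma> \<in> tilings k"
  shows "pmf (edge_flip_chain k (rect ` \<sigma>)) D =
    (\<Sum>p\<in>\<sigma>. \<Sum>s\<in>UNIV. of_bool (flip_edge k (rect ` \<sigma>) (side_of s (rect p)) = D)) / (4 * 2 ^ k)"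
proof -
  have fin: "finite \<sigma>" and card: "card \<sigma> = 2 ^ k" using assms by (auto simp: tilings_def packing_def)
  have ne: "\<sigma> \<noteq> {}" using card by auto
  have inj: "inj_on rect \<sigma>" using inj_rect by (rule inj_on_subset) simp
  have ind: "indicator {D} x = (of_bool (x = D) :: real)" for x
    by (simp add: indicator_def)
  have "pmf (edge_flip_chain k (rect ` \<sigma>)) D =
     (\<Sum>R\<in>rect ` \<sigma>. (\<Sum>s\<in>UNIV. of_bool (flip_edge k (rect ` \<sigma>) (side_of s R) = D)) / 4) / 2 ^ k"
    unfolding edge_flip_chain_def UNIV_direction[symmetric] using fin ne card card_image[OF inj]
    by (simp add: pmf_bind_pmf_of_set card_UNIV_direction ind pmf_return)
  also have "\<dots> = (\<Sum>p\<in>\<sigma>. \<Sum>s\<in>UNIV. of_bool (flip_edge k (rect ` \<sigma>) (side_of s (rect p)) = D)) / (4 * 2 ^ k)"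
    by (simp add: sum.reindex[OF inj] sum_divide_distrib[symmetric])
  finally show ?thesis .
qed

lemma x_halves_neq_y_halves: "x_halves u v \<noteq> y_halves u' v'"
  by (auto simp: x_halves_def y_halves_def doubleton_eq_iff)

lemma halves_inject:
  "x_halves u v = x_halves u' v' \<longleftrightarrow> u = u' \<and> v = v'"
  "y_halves u v = y_halves u' v' \<longleftrightarrow> u = u' \<and> v = v'"
  by (auto simp: x_halves_def y_halves_def doubleton_eq_iff)

lemma removed_halves:
  assumes "\<sigma> \<in> tilings k"
  shows "x_halves u v \<subseteq> \<sigma> \<Longrightarrow> \<sigma> - (\<sigma> - x_halves u v \<union> y_halves u v) = x_halves u v"
    and "y_halves u v \<subseteq> \<sigma> \<Longrightarrow> \<sigma> - (\<sigma> - y_halves u v \<union> x_halves u v) = y_halves u v"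
proof -
  show "\<sigma> - (\<sigma> - x_halves u v \<union> y_halves u v) = x_halves u v" if "x_halves u v \<subseteq> \<sigma>"
    using that y_halves_disjoint[OF assms that] by blast
  show "\<sigma> - (\<sigma> - y_halves u v \<union> x_halves u v) = y_halves u v" if "y_halves u v \<subseteq> \<sigma>"
  proof -
    have "x_halves v u \<subseteq> transp \<sigma>" using that by (metis image_mono transp_halves(2))
    from y_halves_disjoint[OF transp_tilings[OF assms] this]
    have "transp (x_halves u v) \<inter> transp \<sigma> = {}" by (simp only: transp_halves)
    hence "x_halves u v \<inter> \<sigma> = {}" by blast
    thus ?thesis using that by blast
  qed
qed

text \<open>A flip is chosen through exactly two pairs of a tile and a side, namely through the two
  tiles that share the edge. The edge is determined by the two tilings, as the removed tiles form
  the difference of \<open>\<sigma>\<close> and \<open>\<tau>\<close>.\<close>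

lemma card_side_flip:
  assumes \<sigma>: "\<sigma> \<in> tilings k"
  shows "card {(p, s). p \<in> \<sigma> \<and> side_flip \<sigma> s p \<tau>} = (if flip \<sigma> \<tau> then 2 else 0)"
proof -
  consider "flip_xy \<sigma> \<tau>" | "flip_yx \<sigma> \<tau>" | "\<not> flip \<sigma> \<tau>" by (auto simp: flip_def)
  thus ?thesis
  proof cases
    case 1
    then obtain u v where uv: "x_halves u v \<subseteq> \<sigma>" "\<tau> = \<sigma> - x_halves u v \<union> y_halves u v"
      by (auto simp: flip_xy_def)
    have diff: "\<sigma> - \<tau> = x_halves u v" unfolding uv(2) by (rule removed_halves(1)[OF \<sigma> uv(1)])
    have "side_flip \<sigma> s p \<tau> \<longleftrightarrow> s = RightSide \<and> p = (u @ [False], v) \<or> s = LeftSide \<and> p = (u @ [True], v)" for s p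
    proof
      assume "side_flip \<sigma> s p \<tau>"
      thus "s = RightSide \<and> p = (u @ [False], v) \<or> s = LeftSide \<and> p = (u @ [True], v)"
        unfolding side_flip_def
      proof (elim disjE exE conjE)
        fix u' v' assume "x_halves u' v' \<subseteq> \<sigma>" "\<tau> = \<sigma> - x_halves u' v' \<union> y_halves u' v'"
        hence "u' = u" "v' = v" using removed_halves(1)[OF \<sigma>, of u' v'] diff halves_inject by simp_all
        moreover assume "s = RightSide" "p = (u' @ [False], v')"
        ultimately show ?thesis by simp
      next
        fix u' v' assume "x_halves u' v' \<subseteq> \<sigma>" "\<tau> = \<sigma> - x_halves u' v' \<union> y_halves u' v'"
        hence "u' = u" "v' = v" using removed_halves(1)[OF \<sigma>, of u' v'] diff halves_inject by simp_all
        moreover assume "s = LeftSide" "p = (u' @ [True], v')"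
        ultimately show ?thesis by simp
      next
        fix u' v' assume "y_halves u' v' \<subseteq> \<sigma>" "\<tau> = \<sigma> - y_halves u' v' \<union> x_halves u' v'"
        hence False using removed_halves(2)[OF \<sigma>, of u' v'] diff x_halves_neq_y_halves[of u v u' v'] by simp
        thus ?thesis ..
      next
        fix u' v' assume "y_halves u' v' \<subseteq> \<sigma>" "\<tau> = \<sigma> - y_halves u' v' \<union> x_halves u' v'"
        hence False using removed_halves(2)[OF \<sigma>, of u' v'] diff x_halves_neq_y_halves[of u v u' v'] by simp
        thus ?thesis ..
      qed
    qed (use uv in \<open>auto simp: side_flip_def\<close>)
    hence "{(p, s). p \<in> \<sigma> \<and> side_flip \<sigma> s p \<tau>} = {((u @ [False], v), RightSide), ((u @ [True], v), LeftSide)}"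
      using uv(1) by (auto simp: x_halves_def)
    thus ?thesis using 1 by (simp add: flip_def)
  next
    case 2
    then obtain u v where uv: "y_halves u v \<subseteq> \<sigma>" "\<tau> = \<sigma> - y_halves u v \<union> x_halves u v"
      by (auto simp: flip_yx_def)
    have diff: "\<sigma> - \<tau> = y_halves u v" unfolding uv(2) by (rule removed_halves(2)[OF \<sigma> uv(1)])
    have "side_flip \<sigma> s p \<tau> \<longleftrightarrow> s = TopSide \<and> p = (u, v @ [False]) \<or> s = BottomSide \<and> p = (u, v @ [True])" for s p
    proof
      assume "side_flip \<sigma> s p \<tau>"
      thus "s = TopSide \<and> p = (u, v @ [False]) \<or> s = BottomSide \<and> p = (u, v @ [True])"
        unfolding side_flip_def
      proof (elim disjE exE conjE)
        fix u' v' assume "y_halves u' v' \<subseteq> \<sigma>" "\<tau> = \<sigma> - y_halves u' v' \<union> x_halves u' v'"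
        hence "u' = u" "v' = v" using removed_halves(2)[OF \<sigma>, of u' v'] diff halves_inject by simp_all
        moreover assume "s = TopSide" "p = (u', v' @ [False])"
        ultimately show ?thesis by simp
      next
        fix u' v' assume "y_halves u' v' \<subseteq> \<sigma>" "\<tau> = \<sigma> - y_halves u' v' \<union> x_halves u' v'"
        hence "u' = u" "v' = v" using removed_halves(2)[OF \<sigma>, of u' v'] diff halves_inject by simp_all
        moreover assume "s = BottomSide" "p = (u', v' @ [True])"
        ultimately show ?thesis by simp
      next
        fix u' v' assume "x_halves u' v' \<subseteq> \<sigma>" "\<tau> = \<sigma> - x_halves u' v' \<union> y_halves u' v'"
        hence False using removed_halves(1)[OF \<sigma>, of u' v'] diff x_halves_neq_y_halves[of u' v' u v] by simp
        thus ?thesis ..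
      next
        fix u' v' assume "x_halves u' v' \<subseteq> \<sigma>" "\<tau> = \<sigma> - x_halves u' v' \<union> y_halves u' v'"
        hence False using removed_halves(1)[OF \<sigma>, of u' v'] diff x_halves_neq_y_halves[of u' v' u v] by simp
        thus ?thesis ..
      qed
    qed (use uv in \<open>auto simp: side_flip_def\<close>)
    hence "{(p, s). p \<in> \<sigma> \<and> side_flip \<sigma> s p \<tau>} = {((u, v @ [False]), TopSide), ((u, v @ [True]), BottomSide)}"
      using uv(1) by (auto simp: y_halves_def)
    thus ?thesis using 2 by (simp add: flip_def)
  next
    case 3
    hence "{(p, s). p \<in> \<sigma> \<and> side_flip \<sigma> s p \<tau>} = {}" using side_flip_imp_flip by blast
    thus ?thesis using 3 by (simp only: card.empty if_False)
  qed
qed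

lemma pmf_edge_flip_chain_offdiagonal:
  assumes \<sigma>: "\<sigma> \<in> tilings k" and "\<tau> \<noteq> \<sigma>"
  shows "pmf (edge_flip_chain k (rect ` \<sigma>)) (rect ` \<tau>) = (if flip \<sigma> \<tau> then 1 / (2 * 2 ^ k) else 0)"
proof -
  have fin: "finite \<sigma>" using \<sigma> by (auto simp: tilings_def packing_def)
  have iff: "flip_edge k (rect ` \<sigma>) (side_of s (rect p)) = rect ` \<tau> \<longleftrightarrow> side_flip \<sigma> s p \<tau>" if "p \<in> \<sigma>" for p s
    using flip_edge_rect[OF \<sigma> that, of s] \<open>\<tau> \<noteq> \<sigma>\<close> rect_image_eq_iff by metis
  have "(\<Sum>p\<in>\<sigma>. \<Sum>s\<in>UNIV. of_bool (flip_edge k (rect ` \<sigma>) (side_of s (rect p)) = rect ` \<tau>)) =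
      (\<Sum>p\<in>\<sigma>. \<Sum>s\<in>UNIV. of_bool (side_flip \<sigma> s p \<tau>) :: real)"
    by (intro sum.cong refl) (simp add: iff)
  also have "\<dots> = (\<Sum>(p, s)\<in>\<sigma> \<times> UNIV. of_bool (side_flip \<sigma> s p \<tau>))"
    by (rule sum.cartesian_product)
  also have "\<dots> = card ((\<sigma> \<times> UNIV) \<inter> {(p, s). side_flip \<sigma> s p \<tau>})"
    using fin card_UNIV_direction(2) by (simp add: case_prod_unfold sum_of_bool_eq)
  also have "(\<sigma> \<times> UNIV) \<inter> {(p, s). side_flip \<sigma> s p \<tau>} = {(p, s). p \<in> \<sigma> \<and> side_flip \<sigma> s p \<tau>}" by auto
  finally show ?thesis by (simp add: pmf_edge_flip_chain[OF \<sigma>] card_side_flip[OF \<sigma>])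
qed

text \<open>The chain is lazy: a tile is a left or a right half of its parent interval in the first
  coordinate, so at most one of its left and right sides can be flipped; likewise for the top and
  bottom sides.\<close>

lemma pmf_edge_flip_chain_diagonal:
  assumes \<sigma>: "\<sigma> \<in> tilings k"
  shows "pmf (edge_flip_chain k (rect ` \<sigma>)) (rect ` \<sigma>) \<ge> 1 / 2"
proof -
  have card: "card \<sigma> = 2 ^ k" using \<sigma> by (auto simp: tilings_def)
  have "2 \<le> (\<Sum>s\<in>UNIV. of_bool (flip_edge k (rect ` \<sigma>) (side_of s (rect p)) = rect ` \<sigma>) :: real)"
    if p: "p \<in> \<sigma>" for p
  proof -
    have "\<not> (side_flip \<sigma> LeftSide p \<tau> \<and> side_flip \<sigma> RightSide p \<tau>')" for \<tau> \<tau>'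
      by (auto simp: side_flip_def)
    hence "flip_edge k (rect ` \<sigma>) (side_of LeftSide (rect p)) = rect ` \<sigma> \<or>
        flip_edge k (rect ` \<sigma>) (side_of RightSide (rect p)) = rect ` \<sigma>"
      using flip_edge_rect(2)[OF \<sigma> p] by blast
    moreover have "\<not> (side_flip \<sigma> TopSide p \<tau> \<and> side_flip \<sigma> BottomSide p \<tau>')" for \<tau> \<tau>'
      by (auto simp: side_flip_def)
    hence "flip_edge k (rect ` \<sigma>) (side_of TopSide (rect p)) = rect ` \<sigma> \<or>
        flip_edge k (rect ` \<sigma>) (side_of BottomSide (rect p)) = rect ` \<sigma>"
      using flip_edge_rect(2)[OF \<sigma> p] by blast
    moreover have "(\<Sum>s\<in>UNIV. w s) = w LeftSide + w RightSide + w TopSide + w BottomSide"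
      for w :: "direction \<Rightarrow> real"
      by (simp add: UNIV_direction)
    ultimately show ?thesis by (auto simp del: side_of.simps sum_of_bool_eq)
  qed
  hence "(\<Sum>p\<in>\<sigma>. 2) \<le> (\<Sum>p\<in>\<sigma>. \<Sum>s\<in>UNIV. of_bool (flip_edge k (rect ` \<sigma>) (side_of s (rect p)) = rect ` \<sigma>) :: real)"
    by (rule sum_mono)
  thus ?thesis by (simp add: pmf_edge_flip_chain[OF \<sigma>] card field_simps)
qed

lemma set_pmf_edge_flip_chain:
  assumes \<sigma>: "\<sigma> \<in> tilings k"
  shows "set_pmf (edge_flip_chain k (rect ` \<sigma>)) \<subseteq> (`) rect ` tilings k"
proof
  fix D assume "D \<in> set_pmf (edge_flip_chain k (rect ` \<sigma>))"
  hence "pmf (edge_flip_chain k (rect ` \<sigma>)) D \<noteq> 0" by (simp add: set_pmf_iff)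
  hence "(\<Sum>p\<in>\<sigma>. \<Sum>s\<in>UNIV. of_bool (flip_edge k (rect ` \<sigma>) (side_of s (rect p)) = D) :: real) \<noteq> 0"
    by (simp add: pmf_edge_flip_chain[OF \<sigma>])
  then obtain p s where p: "p \<in> \<sigma>" and s: "flip_edge k (rect ` \<sigma>) (side_of s (rect p)) = D"
    by (auto simp del: side_of.simps sum_of_bool_eq elim!: sum.not_neutral_contains_not_neutral)
  obtain \<tau> where "flip_edge k (rect ` \<sigma>) (side_of s (rect p)) = rect ` \<tau>" "\<tau> \<in> tilings k"
    by (rule flip_edge_rect_cases[OF \<sigma> p])
  thus "D \<in> (`) rect ` tilings k" using s by blast
qed

lemma edge_flip_poincare_chain:
  "poincare_chain (dyadic_tilings (Suc k)) (edge_flip_chain (Suc k)) (4 * 16 ^ k)"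
proof
  let ?\<Omega> = "tilings (Suc k)" and ?P = "edge_flip_chain (Suc k)" and ?r = "(`) rect"
  have inj: "inj_on ?r ?\<Omega>" by (auto simp: inj_on_def rect_image_eq_iff)
  show "finite (dyadic_tilings (Suc k))" by (simp add: dyadic_tilings_eq)
  show "set_pmf (?P D) \<subseteq> dyadic_tilings (Suc k)" if "D \<in> dyadic_tilings (Suc k)" for D
  proof -
    obtain \<sigma> where "D = rect ` \<sigma>" "\<sigma> \<in> ?\<Omega>" using \<open>D \<in> dyadic_tilings (Suc k)\<close> unfolding dyadic_tilings_eq ..
    thus ?thesis unfolding dyadic_tilings_eq using set_pmf_edge_flip_chain by simp
  qed
  show "pmf (?P D) E = pmf (?P E) D"
    if DE: "D \<in> dyadic_tilings (Suc k)" "E \<in> dyadic_tilings (Suc k)" for D E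
  proof -
    obtain \<sigma> \<tau> where st: "D = rect ` \<sigma>" "E = rect ` \<tau>" "\<sigma> \<in> ?\<Omega>" "\<tau> \<in> ?\<Omega>"
      using DE by (auto simp: dyadic_tilings_eq)
    show ?thesis
    proof (cases "\<sigma> = \<tau>")
      case False
      moreover have "flip \<sigma> \<tau> \<longleftrightarrow> flip \<tau> \<sigma>" using flip_sym st by blast
      ultimately show ?thesis using st by (simp add: pmf_edge_flip_chain_offdiagonal)
    qed (simp add: st)
  qed
  show "(0 :: real) < 4 * 16 ^ k" by simp
  fix f :: "(real \<times> real) set set \<Rightarrow> real"
  define g where "g = f \<circ> ?r"
  have "(\<Sum>\<sigma>\<in>?\<Omega>. \<Sum>\<tau>\<in>?\<Omega>. pmf (?P (rect ` \<sigma>)) (rect ` \<tau>) * (g \<sigma> - g \<tau>)\<^sup>2) =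
      (\<Sum>\<sigma>\<in>?\<Omega>. \<Sum>\<tau>\<in>?\<Omega>. (if flip \<sigma> \<tau> then (g \<sigma> - g \<tau>)\<^sup>2 else 0) / (2 * 2 ^ Suc k))"
  proof (intro sum.cong refl)
    fix \<sigma> \<tau> assume "\<sigma> \<in> ?\<Omega>"
    thus "pmf (?P (rect ` \<sigma>)) (rect ` \<tau>) * (g \<sigma> - g \<tau>)\<^sup>2 =
        (if flip \<sigma> \<tau> then (g \<sigma> - g \<tau>)\<^sup>2 else 0) / (2 * 2 ^ Suc k)"
      by (cases "\<tau> = \<sigma>") (simp_all add: pmf_edge_flip_chain_offdiagonal)
  qed
  hence energy: "(\<Sum>\<sigma>\<in>?\<Omega>. \<Sum>\<tau>\<in>?\<Omega>. pmf (?P (rect ` \<sigma>)) (rect ` \<tau>) * (g \<sigma> - g \<tau>)\<^sup>2) =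
      dirichlet flip g ?\<Omega> / (2 * 2 ^ Suc k)"
    by (simp add: dirichlet_def sum_divide_distrib)
  have "(\<Sum>\<sigma>\<in>?\<Omega>. \<Sum>\<tau>\<in>?\<Omega>. (g \<sigma> - g \<tau>)\<^sup>2) \<le> real (card ?\<Omega>) * 8 ^ k * dirichlet flip g ?\<Omega>"
    using poincare_tilings[of g k] by (simp add: sqd_def)
  also have "8 ^ k * (2 * 2 ^ Suc k) = (4 * 16 ^ k :: real)"
    by (simp add: power_mult_distrib[symmetric])
  hence "real (card ?\<Omega>) * 8 ^ k * dirichlet flip g ?\<Omega> =
      4 * 16 ^ k * real (card ?\<Omega>) * (dirichlet flip g ?\<Omega> / (2 * 2 ^ Suc k))"
    by (simp add: field_simps)
  finally show "(\<Sum>D\<in>dyadic_tilings (Suc k). \<Sum>E\<in>dyadic_tilings (Suc k). (f D - f E)\<^sup>2)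
      \<le> 4 * 16 ^ k * real (card (dyadic_tilings (Suc k))) *
        (\<Sum>D\<in>dyadic_tilings (Suc k). \<Sum>E\<in>dyadic_tilings (Suc k). pmf (?P D) E * (f D - f E)\<^sup>2)"
    unfolding energy[symmetric] dyadic_tilings_eq by (simp add: sum.reindex[OF inj] card_image[OF inj] g_def)
qed

section \<open>Bounds on the relaxation time and the mixing time\<close>

lemma card_dyadic_tilings: "card (dyadic_tilings k) = card (tilings k)"
  unfolding dyadic_tilings_eq by (rule card_image) (auto simp: inj_on_def rect_image_eq_iff)

theorem theorem1p1:
  shows "(\<exists>C::real. C > 0 \<and> (\<forall>\<^sub>F k in sequentially.
            relaxation_time (dyadic_tilings k) (edge_flip_chain k)
              \<le> ennreal (C * (2 ^ k) powr (log 2 17)))) \<and>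
         (\<exists>C::real. C > 0 \<and> (\<forall>\<^sub>F k in sequentially.
            ennreal_of_enat (mixing_time (dyadic_tilings k) (edge_flip_chain k)
                (pmf_of_set (dyadic_tilings k)) (1 / 4))
              \<le> ennreal (C * (2 ^ k) powr (1 + log 2 17))))"
proof -
  have pow: "(2 ^ k) powr (log 2 17) = (17 ^ k :: real)" for k :: nat
  proof -
    have "((2::real) ^ k) powr (log 2 17) = 2 powr (log 2 17 * k)"
      by (simp add: powr_realpow[symmetric] powr_powr mult.commute)
    also have "\<dots> = (2 powr log 2 17) powr k" by (simp only: powr_powr)
    also have "\<dots> = 17 ^ k" by (simp add: powr_realpow)
    finally show ?thesis .
  qed
  have le: "4 * 16 ^ k \<le> (17 ^ Suc k :: real)" for k
    using power_mono[of "16::real" 17 k] mult_mono[of "4::real" 17 "16 ^ k" "17 ^ k"] by simp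
  have relax: "relaxation_time (dyadic_tilings (Suc k)) (edge_flip_chain (Suc k))
      \<le> ennreal (1 * (2 ^ Suc k) powr (log 2 17))" for k
  proof -
    have "relaxation_time (dyadic_tilings (Suc k)) (edge_flip_chain (Suc k)) \<le> ennreal (4 * 16 ^ k)"
      using poincare_chain.relaxation_time_le[OF edge_flip_poincare_chain] card_tilings_Suc_ge
      by (simp add: card_dyadic_tilings)
    also have "\<dots> \<le> ennreal (1 * (2 ^ Suc k) powr (log 2 17))"
      unfolding pow mult_1 by (rule ennreal_leI[OF le])
    finally show ?thesis .
  qed
  have mix: "ennreal_of_enat (mixing_time (dyadic_tilings (Suc k)) (edge_flip_chain (Suc k))
      (pmf_of_set (dyadic_tilings (Suc k))) (1 / 4)) \<le> ennreal (9 * (2 ^ Suc k) powr (1 + log 2 17))" for k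
  proof -
    let ?N = "card (dyadic_tilings (Suc k))"
    have N: "?N \<ge> 2" using card_tilings_Suc_ge by (simp add: card_dyadic_tilings)
    have "ennreal_of_enat (mixing_time (dyadic_tilings (Suc k)) (edge_flip_chain (Suc k))
        (pmf_of_set (dyadic_tilings (Suc k))) (1 / 4)) \<le> ennreal (4 * 16 ^ k * ln (4 * ?N) + 1)"
    proof (rule poincare_chain.mixing_time_le[OF edge_flip_poincare_chain])
      show "pmf (edge_flip_chain (Suc k) D) D \<ge> 1 / 2" if "D \<in> dyadic_tilings (Suc k)" for D
        using that pmf_edge_flip_chain_diagonal by (auto simp: dyadic_tilings_eq)
      have "(1 :: real) \<le> 16 ^ k" by simp
      thus "(1 :: real) \<le> 4 * 16 ^ k" by linarith
      show "dyadic_tilings (Suc k) \<noteq> {}" using N by auto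
    qed
    also have "\<dots> \<le> ennreal (9 * (2 ^ Suc k) powr (1 + log 2 17))"
    proof (rule ennreal_leI)
      have "4 * ?N \<le> 2 * 2 ^ (2 ^ Suc k)"
        using card_tilings_le[of "Suc k"] by (simp add: card_dyadic_tilings)
      also have "\<dots> = 2 ^ (2 ^ Suc k + 1)" by simp
      finally have "real (4 * ?N) \<le> real (2 ^ (2 ^ Suc k + 1))" by (rule of_nat_mono)
      hence "ln (real (4 * ?N)) \<le> ln (real (2 ^ (2 ^ Suc k + 1)))"
        using N by (intro ln_mono) auto
      also have "\<dots> = real (2 ^ Suc k + 1) * ln 2"
        unfolding of_nat_power of_nat_numeral by (rule ln_realpow)
      also have "\<dots> \<le> real (2 ^ Suc k + 1) * 1"
        using ln_2_less_1 by (intro mult_left_mono) auto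
      also have "\<dots> \<le> 2 * 2 ^ Suc k"
      proof -
        have "(1 :: real) \<le> 2 ^ Suc k" by (rule one_le_power) simp
        thus ?thesis by (simp only: of_nat_add of_nat_power of_nat_numeral of_nat_1 mult_1_right)
      qed
      finally have ln_le: "ln (4 * ?N) \<le> 2 * 2 ^ Suc k" by simp
      have "4 * 16 ^ k * ln (4 * ?N) \<le> 17 ^ Suc k * (2 * 2 ^ Suc k :: real)"
        using N by (intro mult_mono le ln_le) auto
      moreover have "1 \<le> 17 ^ Suc k * (2 ^ Suc k :: real)"
        unfolding power_mult_distrib[symmetric] by (rule one_le_power) simp
      ultimately have "4 * 16 ^ k * ln (4 * ?N) + 1 \<le> 9 * (2 ^ Suc k * (17 ^ Suc k :: real))"
        by (simp only: mult_ac)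
      thus "4 * 16 ^ k * ln (4 * ?N) + 1 \<le> 9 * (2 ^ Suc k) powr (1 + log 2 17)"
        unfolding powr_add pow by simp
    qed
    finally show ?thesis .
  qed
  have shift: "\<forall>\<^sub>F k in sequentially. P k" if "\<And>k. P (Suc k)" for P :: "nat \<Rightarrow> bool"
    using that by (metis eventually_sequentiallyI Suc_le_D One_nat_def)
  show ?thesis
    by (intro conjI exI[of _ 1] exI[of _ 9] shift relax mix) auto
qed

end
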